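(* Let $F:\mathbb{R}^n\to\mathbb{R}$ be a convex differentiable function admitting at least one minimizer, and let $F^*=\min F$. Let $\alpha>0$, $\theta\in[0,1]$, $t_0>0$, $\gamma_1>2$, $\gamma_2\ge\gamma_1$, and $r=\frac{1+\theta}{2}$. Let $x$ be a solution on $[t_0,+\infty)$ of $$\ddot x(t)+\frac{\alpha}{t^\theta}\dot x(t)+\nabla F(x(t))=0 .$$ Suppose that $F$ is coercive and satisfies $\mathbf{H}_1(\gamma_1)$ and $\mathbf{H}_2(\gamma_2)$, and that one of the following holds: 1. $\theta=1$ and $\alpha\ge\frac{\gamma_1+2}{\gamma_1-2}$; or 2. $\theta<1$. Then, as $t\to+\infty$, $$F(x(t))-F^*=O\!\left(\frac{1}{t^{\frac{2r\gamma_2}{\gamma_2-2}}}\right).$$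
   Context: $\mathbb{R}^n$ carries the Euclidean scalar product $\langle\cdot,\cdot\rangle$ and norm $\|\cdot\|$; $B(x^*,\rho)$ is the open ball of center $x^*$ and radius $\rho$; $X^*=\operatorname{argmin}F$; $d(x,X^* )$ is the distance from $x$ to $X^*$; $F^*=\inf F$. Coercive means $F(x)\to+\infty$ as $\|x\|\to+\infty$. Condition $\mathbf{H}_1(\gamma)$ ($\gamma\ge1$): for any minimizer $x^*\in X^*$ there exists $\eta>0$ such that for all $x\in B(x^*,\eta)$, $F(x)-F^*\le\frac1\gamma\langle\nabla F(x),x-x^*\rangle$. Condition $\mathbf{H}_2(r)$ ($r\ge1$): for any minimizer $x^*\in X^*$ there exist $K_r>0$ and $\epsilon>0$ such that for all $x\in B(x^*,\epsilon)$, $K_r\,d(x,X^* )^r\le F(x)-F^*$. Standing assumption: for any initial conditions $(x_0,v_0)\in\mathbb{R}^n\times\mathbb{R}^n$, the Cauchy problem for the differential equation has a unique global solution on $[t_0,+\infty)$ with $(x(t_0),\dot x(t_0))=(x_0,v_0)$. *)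

theory Defs
  imports "HOL-Analysis.Analysis" "HOL-Library.Landau_Symbols"
begin

text \<open>Only meaningful where \<open>F\<close> is differentiable, as for any definite description.\<close>

definition gradient :: "(real ^ 'n \<Rightarrow> real) \<Rightarrow> real ^ 'n \<Rightarrow> real ^ 'n" where
  "gradient F x = (THE g. GDERIV F x :> g)"

definition minimizers :: "(real ^ 'n \<Rightarrow> real) \<Rightarrow> (real ^ 'n) set" where
  "minimizers F = {x. is_arg_min F (\<lambda>_. True) x}"

definition inf_value :: "(real ^ 'n \<Rightarrow> real) \<Rightarrow> real" where
  "inf_value F = (INF x. F x)"

definition coercive :: "(real ^ 'n \<Rightarrow> real) \<Rightarrow> bool" where
  "coercive F \<longleftrightarrow> filterlim F at_top at_infinity"

definition H1 :: "real \<Rightarrow> (real ^ 'n \<Rightarrow> real) \<Rightarrow> bool" where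
  "H1 \<gamma> F \<longleftrightarrow>
    (\<forall>xs \<in> minimizers F. \<exists>\<eta>>0. \<forall>x \<in> ball xs \<eta>.
       F x - inf_value F \<le> (1 / \<gamma>) * (gradient F x \<bullet> (x - xs)))"

definition H2 :: "real \<Rightarrow> (real ^ 'n \<Rightarrow> real) \<Rightarrow> bool" where
  "H2 r F \<longleftrightarrow>
    (\<forall>xs \<in> minimizers F. \<exists>K>0. \<exists>\<epsilon>>0. \<forall>x \<in> ball xs \<epsilon>.
       K * infdist x (minimizers F) powr r \<le> F x - inf_value F)"

text \<open>The trajectory \<open>x\<close> solves
  \<open>x'' + (\<alpha> / t powr \<theta>) x' + gradient F x = 0\<close> on \<open>[t0, \<infinity>)\<close>, with velocity \<open>v = x'\<close>.
  Derivatives at \<open>t0\<close> are one-sided; values of \<open>x\<close> and \<open>v\<close> before \<open>t0\<close> are irrelevant.\<close>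

definition ode_solution ::
  "(real ^ 'n \<Rightarrow> real) \<Rightarrow> real \<Rightarrow> real \<Rightarrow> real \<Rightarrow> (real \<Rightarrow> real ^ 'n) \<Rightarrow> (real \<Rightarrow> real ^ 'n) \<Rightarrow> bool" where
  "ode_solution F \<alpha> \<theta> t0 x v \<longleftrightarrow>
    (\<forall>t\<ge>t0. (x has_vector_derivative v t) (at t within {t0..}) \<and>
      (\<exists>a. (v has_vector_derivative a) (at t within {t0..}) \<and>
           a + (\<alpha> / t powr \<theta>) *\<^sub>R v t + gradient F (x t) = 0))"

text \<open>Uniqueness is uniqueness of the trajectory on \<open>[t0, \<infinity>)\<close>.\<close>

definition well_posed :: "(real ^ 'n \<Rightarrow> real) \<Rightarrow> real \<Rightarrow> real \<Rightarrow> real \<Rightarrow> bool" where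
  "well_posed F \<alpha> \<theta> t0 \<longleftrightarrow>
    (\<forall>x0 v0. \<exists>x v. ode_solution F \<alpha> \<theta> t0 x v \<and> x t0 = x0 \<and> v t0 = v0 \<and>
      (\<forall>y w. ode_solution F \<alpha> \<theta> t0 y w \<and> y t0 = x0 \<and> w t0 = v0 \<longrightarrow> (\<forall>t\<ge>t0. y t = x t)))"

end

theory Submission
  imports Defs "HOL-Real_Asymp.Real_Asymp"
begin

text \<open>
  Write \<open>W = F(x) - F*\<close>, \<open>en = W + |v|^2 / 2\<close>, \<open>X\<close> for the set of minimizers and
  \<open>q = 2 / \<gamma>2\<close>, so that the growth condition reads \<open>d(x, X)^2 \<le> C W^q\<close>.

  For \<open>\<theta> < 1\<close> convexity and growth suffice. An energy \<open>\<Phi> c\<close> centered at a fixed minimizer \<open>c\<close>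
  has \<open>\<Phi>' \<le> - (\<alpha> / (2 t^\<theta>)) en\<close>; taking for \<open>c\<close> the minimizer nearest to \<open>x(t)\<close> bounds the tail
  integral of \<open>en / t^\<theta>\<close> by the values of \<open>en\<close> and \<open>d(x, X)\<close> at time \<open>t\<close>, which is a differential
  inequality for that tail.

  For \<open>\<theta> = 1\<close> put \<open>p = \<alpha> - 1\<close> and \<open>e = t^2 en\<close>. The function \<open>J c = t^p (e + (p/2) t <v, x - c>)\<close>
  decreases wherever the flatness inequality with exponent \<open>\<gamma>1\<close> and center \<open>c\<close> holds. The radius on
  which it holds may degenerate as \<open>c\<close> varies, so one cannot simply take \<open>c\<close> nearest to \<open>x(t)\<close>.
  Instead, first show that \<open>x\<close> converges, with finitely many centers patched along a power diagram:
  the slope of the minimum of \<open>|x - c|^2 - r_c^2\<close> can only jump downwards. With \<open>xb\<close> the limit,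
  the flatness inequality holds at \<open>xb\<close> eventually, hence, up to a loss proportional to \<open>\<mu>\<close>, at all
  centers \<open>xb + \<mu> (z - xb)\<close> with \<open>z \<in> X\<close>. A fixed \<open>\<mu>\<close> yields a polynomial rate for \<open>|x - xb|\<close>;
  then \<open>\<mu> = T^(-\<sigma>)\<close> at the target time \<open>T\<close> makes the loss negligible while these centers still come
  as close to \<open>x(T)\<close> as needed.
\<close>

section \<open>Auxiliary inequalities\<close>

text \<open>A split at \<open>a = M * b\<close> is enough: below it the product is at most
  \<open>M powr q * b\<close>, above it at most \<open>a * M powr (q - 1)\<close>, and
  \<open>M\<close> is chosen to make the last factor equal to \<open>\<epsilon>\<close>. A small
  \<open>\<epsilon>\<close> later lets the first term be absorbed by an energy.\<close>

lemma young_powr: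
  fixes q \<epsilon> :: real
  assumes "0 < q" "q < 1" "0 < \<epsilon>"
  obtains C where "0 < C" "\<And>a b. 0 \<le> a \<Longrightarrow> 0 \<le> b \<Longrightarrow> a powr q * b powr (1 - q) \<le> \<epsilon> * a + C * b"
proof -
  define M where "M = \<epsilon> powr (- 1 / (1 - q))"
  have M: "0 < M" using assms by (simp add: M_def)
  have Me: "M powr (q - 1) = \<epsilon>"
  proof -
    have "- 1 / (1 - q) * (q - 1) = 1" using assms by (simp add: field_simps)
    then show ?thesis using assms unfolding M_def powr_powr by simp
  qed
  have "a powr q * b powr (1 - q) \<le> \<epsilon> * a + M powr q * b" if "0 \<le> a" "0 \<le> b" for a b :: real
  proof (cases "a \<le> M * b")
    case True
    have "a powr q * b powr (1 - q) \<le> (M * b) powr q * b powr (1 - q)"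
      using True that assms by (intro mult_right_mono powr_mono2) auto
    also have "\<dots> = M powr q * b"
      using that M assms by (cases "b = 0") (simp_all add: powr_mult flip: powr_add)
    finally show ?thesis using that assms by (smt (verit) mult_nonneg_nonneg)
  next
    case False
    then have a: "0 < a" and b: "b \<le> a / M" using that M
      by (smt (verit) mult_nonneg_nonneg, simp add: field_simps)
    have "a powr q * b powr (1 - q) \<le> a powr q * (a / M) powr (1 - q)"
      using b that assms by (intro mult_left_mono powr_mono2) auto
    also have "\<dots> = a * M powr (q - 1)"
      using a M assms by (simp add: powr_divide powr_diff)
    finally show ?thesis using that Me M by (smt (verit) mult.commute mult_nonneg_nonneg powr_ge_zero)
  qed
  then show ?thesis using that[of "M powr q"] M by auto
qed

lemma deriv_nonpos_antimono:
  fixes f f' :: "real \<Rightarrow> real"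
  assumes "a \<le> b"
    and "\<And>t. a \<le> t \<Longrightarrow> t \<le> b \<Longrightarrow> (f has_real_derivative f' t) (at t)"
    and "\<And>t. a \<le> t \<Longrightarrow> t \<le> b \<Longrightarrow> f' t \<le> 0"
  shows "f b \<le> f a"
  using DERIV_nonpos_imp_nonincreasing[OF assms(1)] assms(2,3) by blast

text \<open>Finitely many unit directions from \<open>xb\<close> into \<open>S\<close> are
  \<open>\<delta>\<close>-dense among all of them, and each is realized by a segment in
  \<open>S\<close> of length at least \<open>\<rho>\<close>. Scaled by \<open>\<mu>\<close>, these
  segments still have length at least \<open>\<rho> * \<mu>\<close>, so the shrunken copy of
  \<open>S\<close> approximates \<open>S\<close> near \<open>xb\<close> with a relative error that
  does not depend on \<open>\<mu>\<close>.\<close>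

lemma homothety_approx:
  fixes S :: "'a::euclidean_space set"
  assumes "convex S" "xb \<in> S" "bounded S" "0 < \<delta>"
  obtains \<rho> where "0 < \<rho>"
    "\<And>c \<mu>. c \<in> S \<Longrightarrow> 0 < \<mu> \<Longrightarrow> \<mu> \<le> 1 \<Longrightarrow> norm (c - xb) \<le> \<rho> * \<mu> \<Longrightarrow>
       \<exists>z\<in>S. norm (c - (xb + \<mu> *\<^sub>R (z - xb))) \<le> \<delta> * norm (c - xb)"
proof -
  define U where "U = (\<lambda>z. sgn (z - xb)) ` (S - {xb})"
  have "bounded U" unfolding U_def bounded_iff by (auto simp: norm_sgn intro!: exI[of _ 1])
  then have "compact (closure U)" by simp
  moreover have "closure U \<subseteq> \<Union> ((\<lambda>u. ball u \<delta>) ` U)"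
    using \<open>0 < \<delta>\<close> by (auto simp: closure_approachable)
  ultimately obtain U' where U': "U' \<subseteq> U" "finite U'" "closure U \<subseteq> \<Union> ((\<lambda>u. ball u \<delta>) ` U')"
    by (metis (no_types, lifting) compactE_image open_ball)
  have "\<forall>u\<in>U'. \<exists>z\<in>S - {xb}. u = sgn (z - xb)" using U' unfolding U_def by auto
  then obtain Z where Z: "\<And>u. u \<in> U' \<Longrightarrow> Z u \<in> S \<and> Z u \<noteq> xb \<and> u = sgn (Z u - xb)"
    by (metis DiffE insert_iff)
  \<comment> \<open>The inserted \<open>1\<close> covers the case \<open>S = {xb}\<close>, where
    there are no directions.\<close>
  define \<rho> where "\<rho> = Min (insert 1 ((\<lambda>u. norm (Z u - xb)) ` U'))"
  have "0 < \<rho>" unfolding \<rho>_def using U' Z by (auto simp: Min_gr_iff)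
  moreover have "\<exists>z\<in>S. norm (c - (xb + \<mu> *\<^sub>R (z - xb))) \<le> \<delta> * norm (c - xb)"
    if c: "c \<in> S" "0 < \<mu>" "\<mu> \<le> 1" "norm (c - xb) \<le> \<rho> * \<mu>" for c \<mu>
  proof (cases "c = xb")
    case True
    then show ?thesis using assms by (intro bexI[of _ xb]) auto
  next
    case False
    define u where "u = sgn (c - xb)"
    have "u \<in> U" using c False unfolding u_def U_def by auto
    then have "u \<in> \<Union> ((\<lambda>u. ball u \<delta>) ` U')" using U'(3) closure_subset by blast
    then obtain u' where u': "u' \<in> U'" "dist u' u < \<delta>" by auto
    define n where "n = norm (Z u' - xb)"
    have n: "0 < n" "\<rho> \<le> n" using Z u' U' unfolding n_def \<rho>_def by (auto simp: Min_le_iff)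
    have zu: "Z u' - xb = n *\<^sub>R u'" using Z[OF u'(1)] unfolding n_def by (metis norm_eq_zero right_minus_eq scaleR_one sgn_div_norm scaleR_scaleR right_inverse)
    \<comment> \<open>With this \<open>s\<close> the comparison point is as far from
      \<open>xb\<close> as \<open>c\<close> is, so that only the directions \<open>u\<close> and
      \<open>u'\<close> differ.\<close>
    define s where "s = norm (c - xb) / (n * \<mu>)"
    have "norm (c - xb) \<le> n * \<mu>" using c n by (meson mult_right_mono less_imp_le order_trans)
    then have s: "0 \<le> s" "s \<le> 1" using n c by (auto simp: s_def)
    have "xb + s *\<^sub>R (Z u' - xb) \<in> S"
      using convexD[OF assms(1) assms(2), of "Z u'" "1 - s" s] Z[OF u'(1)] s
      by (simp add: algebra_simps)
    moreover have "norm (c - (xb + \<mu> *\<^sub>R (xb + s *\<^sub>R (Z u' - xb) - xb))) \<le> \<delta> * norm (c - xb)"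
    proof -
      have "\<mu> *\<^sub>R (s *\<^sub>R (Z u' - xb)) = norm (c - xb) *\<^sub>R u'"
        unfolding zu using n c by (simp add: s_def)
      moreover have "c - xb = norm (c - xb) *\<^sub>R u" using False by (simp add: u_def sgn_div_norm)
      ultimately have "c - (xb + \<mu> *\<^sub>R (xb + s *\<^sub>R (Z u' - xb) - xb)) = norm (c - xb) *\<^sub>R (u - u')"
        by (simp add: algebra_simps)
      moreover have "norm (c - xb) * norm (u - u') \<le> norm (c - xb) * \<delta>"
        using u' by (intro mult_left_mono) (auto simp: dist_norm norm_minus_commute)
      ultimately show ?thesis by (simp add: mult.commute)
    qed
    ultimately show ?thesis by blast
  qed
  ultimately show ?thesis using that by blast
qed

section \<open>Damped inertial flows\<close>

text \<open>The friction coefficient \<open>a\<close> is abstract so that both regimes share the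
  energy identities. The equation is stated on the open half-line, where derivatives are
  two-sided.\<close>

locale damped_flow =
  fixes F :: "'a::euclidean_space \<Rightarrow> real" and G :: "'a \<Rightarrow> 'a" and m :: real and X :: "'a set"
    and a :: "real \<Rightarrow> real" and t0 :: real and x v :: "real \<Rightarrow> 'a"
  assumes grad: "\<And>y. (F has_derivative (\<lambda>h. G y \<bullet> h)) (at y)"
    and tangent: "\<And>y z. F y + G y \<bullet> (z - y) \<le> F z"
    and X_def: "X = {y. F y = m}" and X_ne: "X \<noteq> {}" and min: "\<And>y. m \<le> F y"
    and convex_X: "convex X"
    and sublevel: "\<And>B. bounded {y. F y \<le> B}"
    and t0: "0 < t0" and a_nonneg: "\<And>t. t0 < t \<Longrightarrow> 0 \<le> a t"
    and x_deriv: "\<And>t. t0 < t \<Longrightarrow> (x has_vector_derivative v t) (at t)"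
    and v_deriv: "\<And>t. t0 < t \<Longrightarrow> (v has_vector_derivative - (a t *\<^sub>R v t) - G (x t)) (at t)"
begin

definition W where "W t = F (x t) - m"
definition en where "en t = W t + (v t \<bullet> v t) / 2"

lemma W_nonneg: "0 \<le> W t" using min by (simp add: W_def)
lemma W_le_en: "W t \<le> en t" by (simp add: en_def)
lemma en_nonneg: "0 \<le> en t" using W_nonneg W_le_en order_trans by blast
lemma v_le_en: "v t \<bullet> v t \<le> 2 * en t" using W_nonneg[of t] by (simp add: en_def)

lemma norm_v_le: "norm (v t) \<le> sqrt (2 * en t)"
  using v_le_en[of t] by (simp add: norm_eq_sqrt_inner)

lemma center: "c \<in> X \<Longrightarrow> W t \<le> G (x t) \<bullet> (x t - c)"
  using tangent[of "x t" c] by (simp add: X_def W_def inner_diff_right)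

lemma continuous_F: "continuous_on UNIV F"
  using grad has_derivative_continuous by (metis continuous_at_imp_continuous_on)

lemma compact_sublevel: "compact {y. F y \<le> B}"
  using sublevel continuous_F by (simp add: compact_eq_bounded_closed closed_Collect_le)

lemma compact_X: "compact X"
proof -
  have "X = {y. F y \<le> m}" using min X_def by (auto intro: antisym)
  then show ?thesis using compact_sublevel by simp
qed

lemma W_deriv: "t0 < t \<Longrightarrow> (W has_real_derivative G (x t) \<bullet> v t) (at t)"
proof -
  assume "t0 < t"
  from has_derivative_compose[OF x_deriv[OF this, unfolded has_vector_derivative_def] grad]
  have "((\<lambda>t. F (x t)) has_derivative (\<lambda>h. G (x t) \<bullet> (h *\<^sub>R v t))) (at t)" .
  then show ?thesis unfolding W_def has_field_derivative_def
    by (auto intro!: derivative_eq_intros simp: mult.commute)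
qed

lemma v_inner_deriv: "t0 < t \<Longrightarrow> ((\<lambda>t. v t \<bullet> v t) has_real_derivative 2 * ((- (a t *\<^sub>R v t) - G (x t)) \<bullet> v t)) (at t)"
  using v_deriv[of t] unfolding has_vector_derivative_def has_field_derivative_def
  by (auto intro!: derivative_eq_intros simp: inner_commute algebra_simps)

lemma en_deriv: "t0 < t \<Longrightarrow> (en has_real_derivative - (a t * (v t \<bullet> v t))) (at t)"
  unfolding en_def
  using DERIV_add[OF W_deriv v_inner_deriv[THEN DERIV_cdivide, of _ 2], of t]
  by (simp add: field_simps inner_diff_left)

lemma f_deriv: "t0 < t \<Longrightarrow> ((\<lambda>t. (x t - c) \<bullet> (x t - c) / 2) has_real_derivative v t \<bullet> (x t - c)) (at t)"
  using x_deriv[of t] unfolding has_vector_derivative_def has_field_derivative_def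
  by (auto intro!: derivative_eq_intros simp: inner_commute[of _ "v t"] field_simps fun_eq_iff inner_diff_right)

lemma g_deriv: "t0 < t \<Longrightarrow> ((\<lambda>t. v t \<bullet> (x t - c)) has_real_derivative
    v t \<bullet> v t - a t * (v t \<bullet> (x t - c)) - G (x t) \<bullet> (x t - c)) (at t)"
  using v_deriv[of t] x_deriv[of t] unfolding has_vector_derivative_def has_field_derivative_def
  by (auto intro!: derivative_eq_intros simp: inner_commute algebra_simps)

lemma en_antimono: "t0 < s \<Longrightarrow> s \<le> t \<Longrightarrow> en t \<le> en s"
  by (rule deriv_nonpos_antimono[where f' = "\<lambda>t. - (a t * (v t \<bullet> v t))"])
     (auto intro!: en_deriv mult_nonneg_nonneg a_nonneg)

lemma F_bounded: "t0 < s \<Longrightarrow> s \<le> t \<Longrightarrow> F (x t) \<le> m + en s"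
  using en_antimono[of s t] W_le_en[of t] by (simp add: W_def)

text \<open>The energy does not increase, so \<open>x t\<close> stays in one bounded sublevel set,
  which contains \<open>X\<close> as well.\<close>

lemma x_bounded:
  assumes "t0 < s"
  obtains R where "0 < R" "\<And>c t. c \<in> X \<Longrightarrow> s \<le> t \<Longrightarrow> norm (x t - c) \<le> R"
proof -
  obtain R1 where R1: "\<And>y. F y \<le> m + en s \<Longrightarrow> norm y \<le> R1"
    using sublevel[of "m + en s"] by (auto simp: bounded_iff)
  have "norm (x t - c) \<le> 2 * \<bar>R1\<bar> + 1" if "c \<in> X" "s \<le> t" for c t
    using R1[of c] R1[OF F_bounded[OF assms that(2)]] that en_nonneg[of s] norm_triangle_ineq4[of "x t" c]
    by (simp add: X_def)
  then show ?thesis using that[of "2 * \<bar>R1\<bar> + 1"] by auto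
qed

lemma continuous_en: "t0 < s \<Longrightarrow> continuous_on {s..} en"
  by (meson DERIV_isCont atLeast_iff continuous_at_imp_continuous_on en_deriv order_less_le_trans)

end

section \<open>Growth of \<open>F\<close> away from its minimizers, in integrable form\<close>

lemma antiderivative_exists:
  fixes h :: "real \<Rightarrow> real"
  assumes "continuous_on {T..} h"
  obtains N where "\<And>t. T < t \<Longrightarrow> (N has_real_derivative h t) (at t)"
proof
  fix t assume "T < t"
  have "((\<lambda>u. integral {T..u} h) has_real_derivative h t) (at t within {T..t + 1})"
    using \<open>T < t\<close> assms by (intro integral_has_real_derivative continuous_on_subset[OF assms]) auto
  moreover have "at t within {T..t + 1} = at t"
    using \<open>T < t\<close> by (intro at_within_interior) auto
  ultimately show "((\<lambda>u. integral {T..u} h) has_real_derivative h t) (at t)" by simp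
qed

locale damped_flow_growth = damped_flow +
  fixes q :: real
  assumes q: "0 < q" "q < 1"
    and growth: "\<And>B. \<exists>C>0. \<forall>y. F y \<le> B \<longrightarrow> (infdist y X)\<^sup>2 \<le> C * (F y - m) powr q"
begin

lemma nearest: obtains c where "c \<in> X" "norm (x t - c) = infdist (x t) X"
  using infdist_attains_inf[of X "x t"] compact_X X_ne by (metis compact_imp_closed dist_norm)

text \<open>Growth bounds the left side by a multiple of
  \<open>(t powr \<delta> * W t) powr q * (t powr M) powr (1 - q)\<close> with
  \<open>M * (1 - q) = - \<beta> - \<delta> * q\<close>, and Young's inequality splits this product.
  The first summand will be absorbed by the energy; the second dictates the rate.\<close>

lemma infdist_young:
  fixes \<beta> \<delta> \<epsilon> s :: real
  assumes "t0 < s" "0 < \<epsilon>"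
  obtains C where "0 < C" "\<And>t. s \<le> t \<Longrightarrow>
    t powr (- \<beta>) * (infdist (x t) X)\<^sup>2 \<le> \<epsilon> * (t powr \<delta> * W t) + C * t powr (- ((\<beta> + \<delta> * q) / (1 - q)))"
proof -
  obtain C1 where C1: "0 < C1" "\<And>y. F y \<le> m + en s \<Longrightarrow> (infdist y X)\<^sup>2 \<le> C1 * (F y - m) powr q"
    using growth by metis
  obtain C where C: "0 < C" "\<And>a b. 0 \<le> a \<Longrightarrow> 0 \<le> b \<Longrightarrow> a powr q * b powr (1 - q) \<le> \<epsilon> / C1 * a + C * b"
    using young_powr[OF q, of "\<epsilon> / C1"] assms C1 by auto
  show ?thesis
  proof (rule that[of "C1 * C"])
    show "0 < C1 * C" using C1 C by simp
    fix t assume t: "s \<le> t"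
    then have t_pos: "0 < t" using assms t0 by simp
    define M where "M = - ((\<beta> + \<delta> * q) / (1 - q))"
    have M: "M * (1 - q) = - \<beta> - \<delta> * q" using q by (simp add: M_def)
    have "t powr (- \<beta>) * (infdist (x t) X)\<^sup>2 \<le> t powr (- \<beta>) * (C1 * W t powr q)"
      using C1(2)[OF F_bounded[OF assms(1) t]] by (intro mult_left_mono) (auto simp: W_def)
    also have "\<dots> = C1 * ((t powr \<delta> * W t) powr q * (t powr M) powr (1 - q))"
      using t_pos W_nonneg[of t] by (simp add: powr_mult powr_powr M flip: powr_add)
    also have "\<dots> \<le> C1 * (\<epsilon> / C1 * (t powr \<delta> * W t) + C * t powr M)"
      using C1 W_nonneg by (intro mult_left_mono C) auto
    also have "\<dots> = \<epsilon> * (t powr \<delta> * W t) + C1 * C * t powr M"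
      using C1 by (simp add: field_simps)
    finally show "t powr (- \<beta>) * (infdist (x t) X)\<^sup>2 \<le> \<epsilon> * (t powr \<delta> * W t) + C1 * C * t powr (- ((\<beta> + \<delta> * q) / (1 - q)))"
      unfolding M_def .
  qed
qed

end

section \<open>Friction exponent below one\<close>

lemma inner_add_scaleR_self:
  "(u + s *\<^sub>R y) \<bullet> (u + s *\<^sub>R y) = u \<bullet> u + 2 * s * (u \<bullet> y) + s\<^sup>2 * (y \<bullet> y)"
  for u y :: "'a::real_inner"
  by (simp add: inner_add_left inner_add_right inner_commute[of y u] power2_eq_square algebra_simps)

locale subcritical_flow = damped_flow_growth F G m X "\<lambda>t. \<alpha> * t powr (- \<theta>)" t0 x v q
  for F :: "'a::euclidean_space \<Rightarrow> real" and G m X \<alpha> \<theta> t0 x v q +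
  assumes \<alpha>: "0 < \<alpha>" and \<theta>: "0 \<le> \<theta>" "\<theta> < 1"
begin

section \<open>Lyapunov function with a fixed center\<close>

text \<open>Write \<open>A\<close> for the friction coefficient and \<open>H\<close> for the
  coefficient of half the squared distance. \<open>H\<close> is the solution of
  \<open>A' = A * A - 2 * H\<close>, which makes all terms in \<open>v t \<bullet> (x t - c)\<close>
  cancel in the derivative.\<close>

definition \<Phi> where "\<Phi> c t = en t + \<alpha> * t powr (- \<theta>) / 2 * (v t \<bullet> (x t - c)) +
  (\<alpha>\<^sup>2 * t powr (- 2 * \<theta>) + \<alpha> * \<theta> * t powr (- \<theta> - 1)) / 2 * ((x t - c) \<bullet> (x t - c) / 2)"

text \<open>After the cancellation there remain \<open>- (A / 2) * (v t \<bullet> v t + P)\<close>,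
  where convexity gives \<open>W t \<le> P\<close>, and \<open>H' * f\<close>, which is nonpositive
  because \<open>H\<close> decreases.\<close>

lemma \<Phi>_deriv:
  assumes "t0 < t" "c \<in> X"
  obtains D where "(\<Phi> c has_real_derivative D) (at t)" "D \<le> - (\<alpha> * t powr (- \<theta>) / 2 * en t)"
proof -
  have t: "0 < t" using assms t0 by simp
  define A where "A = \<alpha> * t powr (- \<theta>)"
  define A' where "A' = \<alpha> * (- \<theta> * t powr (- \<theta> - 1))"
  define f where "f = (x t - c) \<bullet> (x t - c) / 2"
  define g where "g = v t \<bullet> (x t - c)"
  define P where "P = G (x t) \<bullet> (x t - c)"
  define H where "H = (\<alpha>\<^sup>2 * t powr (- 2 * \<theta>) + \<alpha> * \<theta> * t powr (- \<theta> - 1)) / 2"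
  define H' where "H' = (\<alpha>\<^sup>2 * (- 2 * \<theta> * t powr (- 2 * \<theta> - 1)) + \<alpha> * \<theta> * ((- \<theta> - 1) * t powr (- \<theta> - 1 - 1))) / 2"
  have pow: "((\<lambda>u. u powr r) has_real_derivative r * t powr (r - 1)) (at t)" for r
    by (rule has_real_derivative_powr[OF t])
  have d1: "((\<lambda>t. \<alpha> * t powr (- \<theta>) / 2) has_real_derivative A' / 2) (at t)"
    unfolding A'_def by (intro DERIV_cdivide DERIV_cmult pow)
  have d2: "((\<lambda>t. (\<alpha>\<^sup>2 * t powr (- 2 * \<theta>) + \<alpha> * \<theta> * t powr (- \<theta> - 1)) / 2) has_real_derivative H') (at t)"
    unfolding H'_def by (intro DERIV_cdivide DERIV_add DERIV_cmult pow)
  have "(\<Phi> c has_real_derivative - (A * (v t \<bullet> v t)) + (A' / 2 * g + (v t \<bullet> v t - A * g - P) * (A / 2))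
      + (H' * f + g * H)) (at t)"
    unfolding \<Phi>_def A_def f_def g_def P_def H_def
    by (intro DERIV_add DERIV_mult en_deriv g_deriv f_deriv assms d1 d2)
  moreover have "- (A * (v t \<bullet> v t)) + (A' / 2 * g + (v t \<bullet> v t - A * g - P) * (A / 2)) + (H' * f + g * H)
      \<le> - (A / 2 * en t)"
  proof -
    have "t powr (- 2 * \<theta>) = t powr (- \<theta>) * t powr (- \<theta>)" by (simp flip: powr_add)
    then have A'_eq: "A' = A * A - 2 * H"
      unfolding H_def A_def A'_def by (simp add: power2_eq_square field_simps)
    have "- (A * (v t \<bullet> v t)) + (A' / 2 * g + (v t \<bullet> v t - A * g - P) * (A / 2)) + (H' * f + g * H)
        = - (A / 2 * (v t \<bullet> v t + P)) + H' * f"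
      unfolding A'_eq by (simp add: field_simps)
    moreover have "H' * f \<le> 0"
    proof -
      have "H' \<le> 0" unfolding H'_def using \<theta> \<alpha>
        by (intro divide_nonpos_nonneg add_nonpos_nonpos mult_nonneg_nonpos mult_nonpos_nonneg) auto
      moreover have "0 \<le> f" by (simp add: f_def)
      ultimately show ?thesis by (rule mult_nonpos_nonneg)
    qed
    moreover have "A / 2 * en t \<le> A / 2 * (v t \<bullet> v t + P)"
      using center[OF assms(2), of t] inner_ge_zero[of "v t"] \<alpha> unfolding en_def P_def A_def
      by (intro mult_left_mono) (linarith, simp)
    ultimately show ?thesis by linarith
  qed
  ultimately show ?thesis using that unfolding A_def by auto
qed

text \<open>The coefficient of the squared distance in \<open>2 * \<Phi> c t\<close> is at least
  \<open>A\<^sup>2 / 2\<close>, more than completing the square of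
  \<open>v t + (A / 2) *\<^sub>R (x t - c)\<close> requires.\<close>

lemma \<Phi>_nonneg: "0 \<le> \<Phi> c t"
proof -
  define A where "A = \<alpha> * t powr (- \<theta>)"
  have "0 \<le> (v t + (A / 2) *\<^sub>R (x t - c)) \<bullet> (v t + (A / 2) *\<^sub>R (x t - c))" by simp
  also have "\<dots> = v t \<bullet> v t + A * (v t \<bullet> (x t - c)) + A\<^sup>2 / 4 * ((x t - c) \<bullet> (x t - c))"
    unfolding inner_add_scaleR_self by (simp add: power2_eq_square)
  also have "\<dots> \<le> 2 * \<Phi> c t"
  proof -
    define n where "n = (x t - c) \<bullet> (x t - c)"
    define k where "k = \<alpha> * \<theta> * t powr (- \<theta> - 1)"
    have A2: "\<alpha>\<^sup>2 * t powr (- 2 * \<theta>) = A\<^sup>2"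
      unfolding A_def by (simp add: power_mult_distrib power2_eq_square flip: powr_add)
    have "2 * \<Phi> c t = 2 * W t + v t \<bullet> v t + A * (v t \<bullet> (x t - c)) + (A\<^sup>2 * n + k * n) / 2"
      unfolding \<Phi>_def en_def A2 A_def[symmetric] n_def[symmetric] k_def[symmetric] by (simp add: field_simps)
    moreover have "0 \<le> A\<^sup>2 * n" "0 \<le> k * n" using \<alpha> \<theta> by (auto simp: n_def k_def)
    ultimately have "v t \<bullet> v t + A * (v t \<bullet> (x t - c)) + A\<^sup>2 / 4 * n \<le> 2 * \<Phi> c t"
      using W_nonneg[of t] by argo
    then show ?thesis unfolding n_def .
  qed
  finally show ?thesis by simp
qed

text \<open>The square of \<open>v t - A *\<^sub>R (x t - c)\<close> controls the cross term. For
  \<open>1 \<le> t\<close> the power \<open>t powr (- \<theta> - 1)\<close> is dominated by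
  \<open>t powr (- 2 * \<theta>)\<close>, so one weight serves for the whole distance part.\<close>

lemma \<Phi>_le:
  assumes "1 \<le> t"
  shows "\<Phi> c t \<le> 3 / 2 * en t + (\<alpha>\<^sup>2 + \<alpha>) * (t powr (- 2 * \<theta>) * (norm (x t - c))\<^sup>2)"
proof -
  define A where "A = \<alpha> * t powr (- \<theta>)"
  define n where "n = (norm (x t - c))\<^sup>2"
  define w where "w = t powr (- 2 * \<theta>) * n"
  have n: "0 \<le> n" "n = (x t - c) \<bullet> (x t - c)" by (auto simp: n_def power2_norm_eq_inner)
  have A2: "A\<^sup>2 * n = \<alpha>\<^sup>2 * w"
    unfolding A_def w_def by (simp add: power_mult_distrib power2_eq_square flip: powr_add)
  have "0 \<le> (v t + (- A) *\<^sub>R (x t - c)) \<bullet> (v t + (- A) *\<^sub>R (x t - c))" by (rule inner_ge_zero)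
  also have "\<dots> = v t \<bullet> v t - 2 * (A * (v t \<bullet> (x t - c))) + A\<^sup>2 * n"
    unfolding n(2) inner_add_scaleR_self by simp
  finally have 1: "A / 2 * (v t \<bullet> (x t - c)) \<le> en t / 2 + \<alpha>\<^sup>2 * w / 4" using v_le_en[of t] A2 by linarith
  have "t powr (- \<theta> - 1) \<le> t powr (- 2 * \<theta>)" using assms \<theta> by (intro powr_mono) auto
  then have "\<theta> * t powr (- \<theta> - 1) \<le> 1 * t powr (- 2 * \<theta>)" using \<theta> by (intro mult_mono) auto
  then have "\<alpha> * (\<theta> * t powr (- \<theta> - 1)) * n \<le> \<alpha> * (1 * t powr (- 2 * \<theta>)) * n"
    using \<alpha> n(1) by (intro mult_right_mono mult_left_mono) auto
  then have 2: "\<alpha> * \<theta> * t powr (- \<theta> - 1) * n \<le> \<alpha> * w" by (simp add: w_def)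
  have "0 \<le> w" using n by (simp add: w_def)
  then have "0 \<le> \<alpha> * w" "0 \<le> \<alpha>\<^sup>2 * w" using \<alpha> by auto
  moreover have "\<Phi> c t = en t + A / 2 * (v t \<bullet> (x t - c)) + (\<alpha>\<^sup>2 * w + \<alpha> * \<theta> * t powr (- \<theta> - 1) * n) / 4"
    unfolding \<Phi>_def A_def n(2)[symmetric] w_def by (simp add: algebra_simps)
  moreover have "P \<le> 3 / 2 * e + (b + d)"
    if "0 \<le> d" "0 \<le> b" "P = e + g + (b + k) / 4" "g \<le> e / 2 + b / 4" "k \<le> d" for P e g b d k :: real
    using that by argo
  ultimately show ?thesis using 1 2 unfolding n_def[symmetric] w_def[symmetric] distrib_right by blast
qed

text \<open>The tail \<open>L - N t\<close> of the integral of \<open>a * en\<close> satisfies a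
  linear differential inequality, hence decays like \<open>t powr (- m')\<close>; monotonicity of
  \<open>en\<close> turns this into a pointwise bound, and \<open>m' - \<theta> + 1\<close> is the
  exponent claimed.\<close>

lemma W_rate: "\<exists>K T. \<forall>t\<ge>T. W t \<le> K * t powr (- ((1 + \<theta>) / (1 - q)))"
proof -
  define s where "s = max 1 (t0 + 1)"
  have s: "1 \<le> s" "t0 < s" by (auto simp: s_def)
  \<comment> \<open>The exponent that \<open>infdist_young\<close> yields for
    \<open>\<beta> = 2 * \<theta>\<close> and \<open>\<delta> = 1 - \<theta>\<close>.\<close>
  define m' where "m' = (2 * \<theta> + (1 - \<theta>) * q) / (1 - q)"
  have m': "0 \<le> m'" using q \<theta> by (simp add: m'_def)
  define a where "a t = \<alpha> * t powr (- \<theta>)" for t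
  have "continuous_on {s..} (\<lambda>t. a t * en t)"
    unfolding a_def using s t0 by (intro continuous_intros continuous_en) auto
  then obtain N where N: "\<And>t. s < t \<Longrightarrow> (N has_real_derivative a t * en t) (at t)"
    using antiderivative_exists by blast
  have a_pos: "0 < a t" if "s < t" for t using that s \<alpha> by (simp add: a_def)
  have N_mono: "N t \<le> N u" if "s < t" "t \<le> u" for t u
    by (rule DERIV_nonneg_imp_nondecreasing[OF that(2)])
       (use N that a_pos en_nonneg in \<open>metis less_imp_le less_le_trans mult_nonneg_nonneg\<close>)
  \<comment> \<open>\<open>N + 2 * \<Phi> c\<close> decreases and \<open>\<Phi> c\<close> is
    nonnegative. The resulting tail bound holds for each \<open>t\<close> and \<open>c\<close>
    separately, so the center may afterwards be taken nearest to \<open>x t\<close>.\<close>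
  have N_le: "N u \<le> N t + 2 * \<Phi> c t" if "s < t" "s < u" "c \<in> X" for t u c
  proof (cases "t \<le> u")
    case True
    have "\<exists>y. ((\<lambda>t. N t + 2 * \<Phi> c t) has_real_derivative y) (at r) \<and> y \<le> 0" if "t \<le> r" "r \<le> u" for r
    proof -
      have r: "s < r" "t0 < r" using that \<open>s < t\<close> s by auto
      obtain D where D: "(\<Phi> c has_real_derivative D) (at r)" "D \<le> - (a r / 2 * en r)"
        using \<Phi>_deriv[OF r(2) \<open>c \<in> X\<close>] unfolding a_def by blast
      have "((\<lambda>t. N t + 2 * \<Phi> c t) has_real_derivative a r * en r + 2 * D) (at r)"
        by (intro DERIV_add DERIV_cmult N r D)
      then show ?thesis using D(2) by (auto intro!: exI[of _ "a r * en r + 2 * D"])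
    qed
    from DERIV_nonpos_imp_nonincreasing[OF True, of "\<lambda>t. N t + 2 * \<Phi> c t", OF this]
    show ?thesis using \<Phi>_nonneg[of c u] by simp
  next
    case False
    then show ?thesis using N_mono[of u t] that \<Phi>_nonneg[of c t] by simp
  qed
  define L where "L = (SUP u\<in>{s<..}. N u)"
  have bdd: "bdd_above (N ` {s<..})"
    using N_le[of "s + 1"] X_ne by (intro bdd_aboveI2[of _ _ "N (s + 1) + 2 * \<Phi> (SOME c. c \<in> X) (s + 1)"])
      (auto simp: some_in_eq)
  have N_le_L: "N t \<le> L" if "s < t" for t
    unfolding L_def using that by (intro cSUP_upper bdd) auto
  have L_le: "L \<le> N t + 2 * \<Phi> c t" if "s < t" "c \<in> X" for t c
    unfolding L_def using that by (intro cSUP_least N_le) (auto intro: gt_ex)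
  have mult_cancel: "k * (2 * (\<alpha> / (2 * k))) = \<alpha>" if "k \<noteq> 0" for k using that by simp
  \<comment> \<open>Chosen so that \<open>(m' + 1) * (2 * \<epsilon>) = \<alpha>\<close>: one
    \<open>\<epsilon>\<close> pays for the Young term, the other for \<open>3 * en t\<close> once
    \<open>t\<close> is large.\<close>
  define \<epsilon> where "\<epsilon> = \<alpha> / (2 * (m' + 1))"
  have \<epsilon>: "0 < \<epsilon>" using \<alpha> m' by (simp add: \<epsilon>_def)
  have k: "0 < 2 * (\<alpha>\<^sup>2 + \<alpha>)" using \<alpha> by (simp add: add_pos_pos)
  obtain C where C: "0 < C" "\<And>t. s \<le> t \<Longrightarrow> t powr (- (2 * \<theta>)) * (infdist (x t) X)\<^sup>2
      \<le> \<epsilon> / (2 * (\<alpha>\<^sup>2 + \<alpha>)) * (t powr (1 - \<theta>) * W t) + C * t powr (- m')"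
    using infdist_young[OF s(2), of "\<epsilon> / (2 * (\<alpha>\<^sup>2 + \<alpha>))" "2 * \<theta>" "1 - \<theta>"] \<epsilon> k
    unfolding m'_def by (metis divide_pos_pos)
  define C' where "C' = 2 * (\<alpha>\<^sup>2 + \<alpha>) * C"
  have "\<forall>\<^sub>F t in at_top. 3 / \<epsilon> \<le> t powr (1 - \<theta>)"
    using \<theta> by real_asymp
  then obtain T1 where T1: "\<And>t. T1 \<le> t \<Longrightarrow> 3 / \<epsilon> \<le> t powr (1 - \<theta>)"
    by (auto simp: eventually_at_top_linorder)
  define T where "T = max (s + 1) T1"
  have T: "s < T" "T1 \<le> T" by (auto simp: T_def)
  \<comment> \<open>As \<open>a t * en t\<close> is the derivative of \<open>N\<close>, this is the
    differential inequality for the tail; \<open>t powr (m' + 1)\<close> is its integrating factor,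
    used in \<open>Z\<close>.\<close>
  have key: "(m' + 1) * (L - N t) \<le> t * (a t * en t) + (m' + 1) * C' * t powr (- m')" if "T \<le> t" for t
  proof -
    have t: "s < t" "T1 \<le> t" "0 < t" using that T s by auto
    obtain c where c: "c \<in> X" "norm (x t - c) = infdist (x t) X" using nearest by blast
    have "L - N t \<le> 2 * \<Phi> c t" using L_le[OF t(1) c(1)] by simp
    also have "\<dots> \<le> 3 * en t + 2 * (\<alpha>\<^sup>2 + \<alpha>) * (t powr (- (2 * \<theta>)) * (infdist (x t) X)\<^sup>2)"
      using \<Phi>_le[of t c] t s c(2) by (simp add: algebra_simps)
    also have "\<dots> \<le> 3 * en t + 2 * (\<alpha>\<^sup>2 + \<alpha>) * (\<epsilon> / (2 * (\<alpha>\<^sup>2 + \<alpha>)) * (t powr (1 - \<theta>) * W t) + C * t powr (- m'))"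
      using C(2)[of t] t k by (intro add_left_mono mult_left_mono) auto
    also have "\<dots> = 3 * en t + \<epsilon> * (t powr (1 - \<theta>) * W t) + C' * t powr (- m')"
      using k by (simp add: C'_def distrib_left)
    also have "3 * en t \<le> (\<epsilon> * t powr (1 - \<theta>)) * en t"
      using T1[OF t(2)] \<epsilon> by (intro mult_right_mono en_nonneg) (simp add: field_simps)
    also have "\<epsilon> * (t powr (1 - \<theta>) * W t) \<le> \<epsilon> * (t powr (1 - \<theta>) * en t)"
      using \<epsilon> by (intro mult_left_mono W_le_en) auto
    finally have "L - N t \<le> 2 * \<epsilon> * t powr (1 - \<theta>) * en t + C' * t powr (- m')" by simp
    then have "(m' + 1) * (L - N t) \<le> (m' + 1) * (2 * \<epsilon> * t powr (1 - \<theta>) * en t + C' * t powr (- m'))"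
      using m' by (intro mult_left_mono) auto
    also have "\<dots> = ((m' + 1) * (2 * \<epsilon>)) * t powr (1 - \<theta>) * en t + (m' + 1) * C' * t powr (- m')"
      by (simp add: algebra_simps)
    also have "(m' + 1) * (2 * \<epsilon>) = \<alpha>" unfolding \<epsilon>_def using m' by (intro mult_cancel) simp
    also have "\<alpha> * t powr (1 - \<theta>) * en t = t * (a t * en t)"
      using t by (simp add: a_def powr_diff powr_minus field_simps)
    finally show ?thesis .
  qed
  define C2 where "C2 = (m' + 1) * C'"
  define Z where "Z t = t powr (m' + 1) * (L - N t) - C2 * t" for t
  have Z: "Z t \<le> Z T" if "T \<le> t" for t
  proof (rule deriv_nonpos_antimono[OF that])
    fix r assume "T \<le> r"
    then have r: "s < r" "0 < r" using T s by auto
    show "(Z has_real_derivative ((m' + 1) * r powr (m' + 1 - 1) * (L - N r) + (0 - a r * en r) * r powr (m' + 1)) - C2 * 1) (at r)"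
      unfolding Z_def
      by (intro DERIV_diff DERIV_mult DERIV_cmult DERIV_const N r has_real_derivative_powr DERIV_ident)
    have "((m' + 1) * r powr (m' + 1 - 1) * (L - N r) + (0 - a r * en r) * r powr (m' + 1)) - C2 * 1
      = r powr m' * ((m' + 1) * (L - N r) - r * (a r * en r)) - C2"
      using r by (simp add: powr_add algebra_simps)
    also have "\<dots> \<le> r powr m' * (C2 * r powr (- m')) - C2"
      using key[OF \<open>T \<le> r\<close>] by (intro diff_right_mono mult_left_mono) (auto simp: C2_def)
    also have "\<dots> = 0" using r by (simp add: powr_minus)
    finally show "((m' + 1) * r powr (m' + 1 - 1) * (L - N r) + (0 - a r * en r) * r powr (m' + 1)) - C2 * 1 \<le> 0" .
  qed
  define C3 where "C3 = C2 + \<bar>Z T\<bar>"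
  have tail: "L - N t \<le> C3 * t powr (- m')" if "T \<le> t" for t
  proof -
    have t: "1 \<le> t" using that T s by simp
    have "t powr (m' + 1) * (L - N t) \<le> C2 * t + \<bar>Z T\<bar> * 1" using Z[OF that] unfolding Z_def by simp
    also have "\<dots> \<le> C2 * t + \<bar>Z T\<bar> * t" using t by (intro add_left_mono mult_left_mono) auto
    also have "\<dots> = t * C3" by (simp add: C3_def algebra_simps)
    finally have "t * (t powr m' * (L - N t)) \<le> t * C3" using t by (simp add: powr_add mult.assoc mult.left_commute)
    then have "t powr m' * (L - N t) \<le> C3" using t by simp
    then show ?thesis using t by (simp add: powr_minus field_simps)
  qed
  define K where "K = C3 * 2 powr (m' + 1) / \<alpha>"
  have "W t \<le> K * t powr (- ((1 + \<theta>) / (1 - q)))" if "2 * T \<le> t" for t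
  proof -
    \<comment> \<open>On \<open>{t / 2..t}\<close> the decreasing integrand \<open>a * en\<close> is
      at least its final value \<open>k\<close>, so the tail beyond \<open>t / 2\<close> bounds
      \<open>k * (t / 2)\<close>.\<close>
    define h where "h = t / 2"
    have h: "T \<le> h" "s < h" "h \<le> t" "t = 2 * h" "0 < t" "0 < h" using that T s by (auto simp: h_def)
    define k where "k = a t * en t"
    have "N h - k * h \<le> N t - k * t"
    proof (rule DERIV_nonneg_imp_nondecreasing[OF h(3)])
      fix r assume r: "h \<le> r" "r \<le> t"
      have "k \<le> a r * en r" unfolding k_def a_def
        using r h s \<alpha> \<theta> by (intro mult_mono mult_left_mono powr_mono2' en_antimono) (auto intro: en_nonneg)
      moreover have "((\<lambda>t. N t - k * t) has_real_derivative a r * en r - k * 1) (at r)"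
        using r h by (intro DERIV_diff DERIV_cmult N DERIV_ident) auto
      ultimately show "\<exists>y. ((\<lambda>t. N t - k * t) has_real_derivative y) (at r) \<and> 0 \<le> y"
        by (intro exI[of _ "a r * en r - k * 1"]) simp
    qed
    then have "k * h \<le> C3 * h powr (- m')"
      using tail[OF h(1)] N_le_L[of t] h by (simp add: algebra_simps)
    then have "\<alpha> * t powr (- \<theta>) * en t * t \<le> C3 * 2 * (t / 2) powr (- m')"
      unfolding k_def a_def h_def by simp
    also have "\<dots> = C3 * 2 powr (m' + 1) * t powr (- m')"
      using h by (simp add: powr_mult powr_divide powr_add powr_minus field_simps)
    finally have "en t \<le> K * (t powr (- m') * t powr \<theta> * t powr (- 1))"
      using h \<alpha> by (simp add: K_def powr_minus field_simps)
    also have "t powr (- m') * t powr \<theta> * t powr (- 1) = t powr (- ((1 + \<theta>) / (1 - q)))"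
    proof -
      have "- m' + \<theta> + (- 1) = - ((1 + \<theta>) / (1 - q))"
        using q by (simp add: m'_def field_simps)
      then show ?thesis by (simp only: powr_add[symmetric])
    qed
    finally show ?thesis using W_le_en[of t] by simp
  qed
  then show ?thesis by blast
qed

end

section \<open>Convergence of the trajectory for friction of order 1/t\<close>

lemma continuous_on_Min_finite:
  fixes Y :: "'i \<Rightarrow> 'a::topological_space \<Rightarrow> real"
  assumes "finite I" "I \<noteq> {}" "\<And>c. c \<in> I \<Longrightarrow> continuous_on S (Y c)"
  shows "continuous_on S (\<lambda>s. Min ((\<lambda>c. Y c s) ` I))"
  using assms by (induction I rule: finite_ne_induct) (auto intro!: continuous_on_min)

text \<open>
  If \<open>t^(p+1) D c\<close> decreases whenever \<open>Y c\<close> is the active branch, then the minimum is concave as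
  a function of \<open>- t^(-p)\<close>, hence stays below its tangent at \<open>T\<close>. The leftmost minimum of the
  difference to a steeper line would be flat to its left.
\<close>

lemma min_barrier:
  fixes Y D :: "'i \<Rightarrow> real \<Rightarrow> real" and p T k :: real
  assumes I: "finite I" "I \<noteq> {}" and p: "0 < p" and T: "0 < T"
    and der: "\<And>c t. c \<in> I \<Longrightarrow> T \<le> t \<Longrightarrow> (Y c has_real_derivative D c t) (at t)"
    and loc: "\<And>c t. c \<in> I \<Longrightarrow> T < t \<Longrightarrow> Y c t = Min ((\<lambda>c. Y c t) ` I) \<Longrightarrow>
        \<exists>u. T \<le> u \<and> u < t \<and> (\<forall>s\<in>{u..t}. t powr (p + 1) * D c t \<le> s powr (p + 1) * D c s)"
    and c0: "c0 \<in> I" "Y c0 T = Min ((\<lambda>c. Y c T) ` I)" "T powr (p + 1) * D c0 T < k"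
    and t: "T \<le> t"
  shows "Min ((\<lambda>c. Y c t) ` I) \<le> Min ((\<lambda>c. Y c T) ` I) + k / p * (T powr (- p) - t powr (- p))"
proof (rule ccontr)
  \<comment> \<open>An affine function of \<open>- s powr (- p)\<close> that meets the minimum at
    \<open>T\<close> and is strictly steeper there than the branch \<open>c0\<close>.\<close>
  define l where "l s = Y c0 T + k / p * (T powr (- p) - s powr (- p))" for s
  define \<psi> where "\<psi> s = Min ((\<lambda>c. Y c s) ` I) - l s" for s
  have l_der: "(l has_real_derivative k * s powr (- p - 1)) (at s)" if "T \<le> s" for s
    unfolding l_def using that T p
    by (auto intro!: derivative_eq_intros has_real_derivative_powr simp: field_simps)
  have Y_l_der: "((\<lambda>s. Y c s - l s) has_real_derivative D c s - k * s powr (- p - 1)) (at s)"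
    if "c \<in> I" "T \<le> s" for c s
    using that by (intro DERIV_diff der l_der)
  have \<psi>_le: "\<psi> s \<le> Y c s - l s" if "c \<in> I" for c s
    unfolding \<psi>_def using I that by simp
  assume "\<not> ?thesis"
  then have t_pos: "0 < \<psi> t" by (simp add: \<psi>_def l_def c0)
  have "continuous_on {T..t} (\<lambda>s. Min ((\<lambda>c. Y c s) ` I))"
    using I by (intro continuous_on_Min_finite) (auto intro!: DERIV_isCont der continuous_at_imp_continuous_on)
  moreover have "continuous_on {T..t} l"
    by (auto intro!: DERIV_isCont l_der continuous_at_imp_continuous_on)
  ultimately have cont: "continuous_on {T..t} \<psi>"
    unfolding \<psi>_def by (intro continuous_on_diff)
  have \<psi>T: "\<psi> T = 0" by (simp add: \<psi>_def l_def c0)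
  then have "T < t" using t t_pos by (cases "T = t") auto
  have pow: "s powr (p + 1) * (k * s powr (- p - 1)) = k" if "T \<le> s" for s
    using that T by (simp add: powr_diff powr_minus powr_add field_simps)
  have dneg: "D c0 T - k * T powr (- p - 1) < 0"
  proof -
    have "T powr (p + 1) * D c0 T < T powr (p + 1) * (k * T powr (- p - 1))"
      unfolding pow[OF order_refl] by (rule c0)
    then show ?thesis using T by (simp add: mult_less_cancel_left)
  qed
  obtain d where d: "0 < d" "\<And>h. 0 < h \<Longrightarrow> h < d \<Longrightarrow> Y c0 (T + h) - l (T + h) < Y c0 T - l T"
    using DERIV_neg_dec_right[OF Y_l_der[OF c0(1) order_refl] dneg] by auto
  define h where "h = min (d / 2) (t - T)"
  have h: "0 < h" "h < d" "T + h \<le> t" using d \<open>T < t\<close> by (auto simp: h_def)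
  have neg: "\<psi> (T + h) < 0"
    using d(2)[OF h(1,2)] \<psi>_le[OF c0(1), of "T + h"] by (simp add: l_def)
  obtain b where b: "b \<in> {T..t}" "\<And>s. s \<in> {T..t} \<Longrightarrow> \<psi> b \<le> \<psi> s"
    using continuous_attains_inf[OF compact_Icc _ cont] \<open>T < t\<close> by auto
  have b_neg: "\<psi> b < 0" using b(2)[of "T + h"] neg h by auto
  \<comment> \<open>\<open>\<psi>\<close> vanishes at \<open>T\<close>, is negative just after
    \<open>T\<close> and positive at \<open>t\<close>, so its minimum is attained strictly inside
    the interval. The leftmost minimum point is taken.\<close>
  define M where "M = {s \<in> {T..t}. \<psi> s = \<psi> b}"
  have "closed M" unfolding M_def
    using continuous_closed_preimage_constant[OF cont closed_atLeastAtMost] by simp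
  moreover have "M \<noteq> {}" "bdd_below M" using b by (auto simp: M_def)
  ultimately have "Inf M \<in> M" by (rule closed_contains_Inf[rotated 2])
  define r where "r = Inf M"
  have r: "T \<le> r" "r \<le> t" "\<psi> r = \<psi> b" using \<open>Inf M \<in> M\<close> by (auto simp: M_def r_def)
  have r_least: "r \<le> s" if "s \<in> M" for s unfolding r_def by (intro cInf_lower that \<open>bdd_below M\<close>)
  have r_int: "T < r" "r < t" using r b_neg t_pos \<psi>T by (auto simp: less_le)
  have "Min ((\<lambda>c. Y c r) ` I) \<in> (\<lambda>c. Y c r) ` I" using I by (intro Min_in) auto
  then obtain c where c: "c \<in> I" "Y c r = Min ((\<lambda>c. Y c r) ` I)" by auto
  have at_r: "Y c r - l r = \<psi> b" using c r by (simp add: \<psi>_def)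
  \<comment> \<open>\<open>Y c - l\<close> lies above \<open>\<psi>\<close> and touches it at
    \<open>r\<close>, so it has a local minimum there as well.\<close>
  have "D c r - k * r powr (- p - 1) = 0"
  proof (rule DERIV_local_min[OF Y_l_der[OF c(1) r(1)]])
    show "0 < min (r - T) (t - r)" using r_int by simp
    show "\<forall>y. \<bar>r - y\<bar> < min (r - T) (t - r) \<longrightarrow> Y c r - l r \<le> Y c y - l y"
    proof (intro allI impI)
      fix y assume "\<bar>r - y\<bar> < min (r - T) (t - r)"
      then have "y \<in> {T..t}" by auto
      then show "Y c r - l r \<le> Y c y - l y" using b(2)[of y] \<psi>_le[OF c(1), of y] at_r by simp
    qed
  qed
  then have rD: "r powr (p + 1) * D c r = k" using pow[OF r(1)] by simp
  \<comment> \<open>Left of \<open>r\<close> the weighted slope of this branch is at least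
    \<open>k\<close>, so \<open>Y c - l\<close> does not decrease from \<open>u\<close> to
    \<open>r\<close>, and \<open>u\<close> is a minimum point of \<open>\<psi>\<close> further
    left.\<close>
  obtain u where u: "T \<le> u" "u < r" "\<And>s. s \<in> {u..r} \<Longrightarrow> k \<le> s powr (p + 1) * D c s"
    using loc[OF c(1) r_int(1) c(2)] rD by auto
  have "Y c u - l u \<le> Y c r - l r"
  proof (rule DERIV_nonneg_imp_nondecreasing[of u r "\<lambda>s. Y c s - l s"])
    fix s assume s: "u \<le> s" "s \<le> r"
    then have "T \<le> s" using u by simp
    then have "s powr (p + 1) * (k * s powr (- p - 1)) \<le> s powr (p + 1) * D c s"
      unfolding pow[OF \<open>T \<le> s\<close>] using u(3)[of s] s by simp
    then have "0 \<le> D c s - k * s powr (- p - 1)"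
      using s u T by (simp add: mult_le_cancel_left)
    then show "\<exists>y. ((\<lambda>s. Y c s - l s) has_real_derivative y) (at s) \<and> 0 \<le> y"
      using Y_l_der[OF c(1), of s] s u by auto
  qed (use u in simp)
  then have "\<psi> u \<le> \<psi> b" using \<psi>_le[OF c(1), of u] at_r by simp
  then have "u \<in> M" using b(2)[of u] u r by (auto simp: M_def)
  then show False using r_least u by fastforce
qed

text \<open>Here \<open>p\<close> stands for \<open>\<alpha> - 1\<close>, and
  \<open>p\<gamma>\<close> is the condition
  \<open>\<alpha> \<ge> (\<gamma> + 2) / (\<gamma> - 2)\<close> solved for \<open>p\<close>. By
  \<open>pq\<close> the decay \<open>t powr (- p)\<close> coming from \<open>J\<close> is at least
  as fast as the rate aimed at for \<open>e\<close>.\<close>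

locale critical_flow = damped_flow_growth F G m X "\<lambda>t. (1 + p) / t" t0 x v q
  for F :: "'a::euclidean_space \<Rightarrow> real" and G m X p t0 x v q +
  fixes \<gamma> :: real
  assumes p: "0 < p" and p\<gamma>: "2 + p \<le> p / 2 * \<gamma>" and pq: "2 * q / (1 - q) \<le> p"
    and flat: "\<And>c. c \<in> X \<Longrightarrow> \<exists>\<eta>>0. \<forall>y\<in>ball c \<eta>. \<gamma> * (F y - m) \<le> G y \<bullet> (y - c)"
begin

section \<open>Rescaled energies for friction of order 1/t\<close>

definition e where "e t = t\<^sup>2 * en t"
text \<open>\<open>E c t / t\<close> is the derivative of
  \<open>(p / 4) * (norm (x t - c))\<^sup>2\<close> plus an antiderivative of
  \<open>e t / t\<close>. The factor \<open>t powr p\<close> in \<open>J\<close> removes the damping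
  term \<open>- (p / t) * E c t\<close> from the derivative of \<open>E c\<close>.\<close>

definition E where "E c t = e t + p / 2 * (t * (v t \<bullet> (x t - c)))"
definition J where "J c t = t powr p * E c t"

lemma \<gamma>: "2 < \<gamma>"
proof -
  have "p / 2 * 2 < p / 2 * \<gamma>" using p\<gamma> p by linarith
  then show ?thesis using p by (subst (asm) mult_less_cancel_left_pos) auto
qed

lemma e_nonneg: "0 \<le> e t" using en_nonneg by (simp add: e_def)

lemma W_le_e: "t\<^sup>2 * W t \<le> e t" unfolding e_def by (intro mult_left_mono W_le_en) auto

lemma tg_le: "0 \<le> t \<Longrightarrow> \<bar>t * (v t \<bullet> (x t - c))\<bar> \<le> sqrt (2 * e t) * norm (x t - c)"
proof -
  assume "0 \<le> t"
  have "\<bar>t * (v t \<bullet> (x t - c))\<bar> = t * \<bar>v t \<bullet> (x t - c)\<bar>" using \<open>0 \<le> t\<close> by (simp add: abs_mult)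
  also have "\<dots> \<le> t * (norm (v t) * norm (x t - c))"
    using \<open>0 \<le> t\<close> by (intro mult_left_mono Cauchy_Schwarz_ineq2)
  also have "\<dots> \<le> t * (sqrt (2 * en t) * norm (x t - c))"
    using \<open>0 \<le> t\<close> by (intro mult_left_mono mult_right_mono norm_v_le) auto
  also have "\<dots> = sqrt (2 * e t) * norm (x t - c)"
    using \<open>0 \<le> t\<close> by (simp add: e_def real_sqrt_mult)
  finally show ?thesis .
qed

lemma tg_deriv:
  assumes "t0 < t"
  shows "((\<lambda>t. t * (v t \<bullet> (x t - c))) has_real_derivative
    t * (v t \<bullet> v t) - p * (v t \<bullet> (x t - c)) - t * (G (x t) \<bullet> (x t - c))) (at t)"
proof -
  have t: "0 < t" using assms t0 by simp
  show ?thesis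
    by (rule DERIV_cong[OF DERIV_mult[OF DERIV_ident g_deriv[OF assms, of c]]])
       (use t in \<open>simp add: field_simps\<close>)
qed

lemma e_deriv:
  assumes "t0 < t"
  shows "(e has_real_derivative 2 * t * W t - p * t * (v t \<bullet> v t)) (at t)"
proof -
  have t: "0 < t" using assms t0 by simp
  have "(e has_real_derivative 2 * t * en t + (- ((1 + p) / t * (v t \<bullet> v t))) * t\<^sup>2) (at t)"
    unfolding e_def using t by (intro DERIV_mult en_deriv assms) (auto intro!: derivative_eq_intros)
  then show ?thesis
    by (rule DERIV_cong) (use t in \<open>simp add: en_def field_simps power2_eq_square\<close>)
qed

lemma E_deriv:
  assumes "t0 < t"
  shows "(E c has_real_derivative
    - (p / t * E c t) + t * ((2 + p) * W t - p / 2 * (G (x t) \<bullet> (x t - c)))) (at t)"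
proof -
  have t: "0 < t" using assms t0 by simp
  show ?thesis unfolding E_def
    by (rule DERIV_cong[OF DERIV_add[OF e_deriv[OF assms] DERIV_cmult[OF tg_deriv[OF assms, of c]]]])
       (use t in \<open>simp add: e_def en_def field_simps power2_eq_square\<close>)
qed

lemma J_deriv:
  assumes "t0 < t"
  shows "(J c has_real_derivative
    t powr (p + 1) * ((2 + p) * W t - p / 2 * (G (x t) \<bullet> (x t - c)))) (at t)"
proof -
  have t: "0 < t" using assms t0 by simp
  show ?thesis unfolding J_def
    by (rule DERIV_cong[OF DERIV_mult[OF has_real_derivative_powr[OF t] E_deriv[OF assms, of c]]])
       (use t in \<open>simp add: powr_diff powr_add field_simps\<close>)
qed

lemma J_antimono:
  assumes "t0 < s" "s \<le> t" "\<And>u. s \<le> u \<Longrightarrow> u \<le> t \<Longrightarrow> \<gamma> * W u \<le> G (x u) \<bullet> (x u - c)"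
  shows "J c t \<le> J c s"
proof (rule deriv_nonpos_antimono[OF assms(2) J_deriv])
  fix u assume u: "s \<le> u" "u \<le> t"
  then show "t0 < u" using assms by simp
  have "(2 + p) * W u \<le> p / 2 * \<gamma> * W u" by (intro mult_right_mono p\<gamma> W_nonneg)
  also have "\<dots> \<le> p / 2 * (G (x u) \<bullet> (x u - c))" using assms(3)[OF u] p by (simp add: mult.assoc)
  finally show "u powr (p + 1) * ((2 + p) * W u - p / 2 * (G (x u) \<bullet> (x u - c))) \<le> 0"
    by (intro mult_nonneg_nonpos) auto
qed

section \<open>Vanishing of the energy\<close>

text \<open>If \<open>en\<close> stayed above some \<open>\<epsilon>\<close>, the integral of
  \<open>en t / t\<close> would diverge like \<open>\<epsilon> * ln t\<close>, whereas the
  derivative of \<open>v t \<bullet> (x t - c) / t\<close> controls it by bounded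
  quantities.\<close>

lemma en_tendsto_0: "(en \<longlongrightarrow> 0) at_top"
proof (rule tendstoI)
  fix \<epsilon> :: real assume \<epsilon>: "0 < \<epsilon>"
  define s where "s = t0 + 1"
  have s: "t0 < s" "1 \<le> s" using t0 by (auto simp: s_def)
  have "\<exists>T\<ge>s. en T < \<epsilon>"
  proof (rule ccontr)
    assume "\<not> ?thesis"
    then have large: "\<And>t. s \<le> t \<Longrightarrow> \<epsilon> \<le> en t" by (meson not_less)
    obtain c where c: "c \<in> X" using X_ne by auto
    obtain R where R: "0 < R" "\<And>t. s \<le> t \<Longrightarrow> norm (x t - c) \<le> R" using x_bounded[OF s(1)] c by metis
    define B where "B = sqrt (2 * en s) * R"
    have g_le: "\<bar>v t \<bullet> (x t - c)\<bar> \<le> B" if "s \<le> t" for t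
    proof -
      have "norm (v t) \<le> sqrt (2 * en s)"
        using norm_v_le[of t] en_antimono[OF s(1) that] by (meson mult_left_mono order_trans real_sqrt_le_mono zero_le_numeral)
      then show ?thesis unfolding B_def using R(2)[OF that] en_nonneg[of s]
        by (intro order_trans[OF Cauchy_Schwarz_ineq2] mult_mono) auto
    qed
    have B: "0 \<le> B" using g_le[of s] by simp
    \<comment> \<open>The multiple of \<open>en\<close> turns the surplus
      \<open>v u \<bullet> v u / u\<close> into \<open>- (v u \<bullet> v u) / (2 * u)\<close>; the
      last term dominates the remaining error of order \<open>1 / u\<^sup>2\<close>, since
      \<open>B\<close> bounds the inner product.\<close>
    define Z where "Z t = (v t \<bullet> (x t - c)) * (1 / t) + 3 / (2 * (1 + p)) * en t + \<epsilon> * ln t + (2 + p) * B * (1 / t)" for t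
    have "Z t \<le> Z s" if "s \<le> t" for t
    proof (rule deriv_nonpos_antimono[OF that])
      fix u assume "s \<le> u"
      then have u: "0 < u" "t0 < u" "s \<le> u" using s by auto
      define g where "g = v u \<bullet> (x u - c)"
      define P where "P = G (x u) \<bullet> (x u - c)"
      have inv: "((\<lambda>t. 1 / t) has_real_derivative - 1 / u\<^sup>2) (at u)"
        using u by (auto intro!: derivative_eq_intros simp: power2_eq_square)
      show "(Z has_real_derivative (v u \<bullet> v u - (1 + p) / u * g - P) * (1 / u) + (- 1 / u\<^sup>2) * g
          + 3 / (2 * (1 + p)) * (- ((1 + p) / u * (v u \<bullet> v u))) + \<epsilon> * (1 / u) + (2 + p) * B * (- 1 / u\<^sup>2)) (at u)"
        unfolding Z_def g_def P_def using u
        by (intro DERIV_add DERIV_mult DERIV_cmult g_deriv en_deriv inv) (auto intro!: derivative_eq_intros)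
      have "(v u \<bullet> v u - (1 + p) / u * g - P) * (1 / u) + (- 1 / u\<^sup>2) * g
          + 3 / (2 * (1 + p)) * (- ((1 + p) / u * (v u \<bullet> v u))) + \<epsilon> * (1 / u) + (2 + p) * B * (- 1 / u\<^sup>2)
        = (1 / u) * (\<epsilon> - (P + v u \<bullet> v u / 2)) - (2 + p) / u\<^sup>2 * (g + B)"
        using u p by (simp add: power2_eq_square divide_simps) (simp add: algebra_simps)
      also have "\<dots> \<le> 0"
      proof -
        have "\<epsilon> \<le> P + v u \<bullet> v u / 2" using large[OF u(3)] center[OF c, of u] by (simp add: en_def P_def)
        then have "(1 / u) * (\<epsilon> - (P + v u \<bullet> v u / 2)) \<le> 0" using u by (intro mult_nonneg_nonpos) auto
        moreover have "0 \<le> (2 + p) / u\<^sup>2 * (g + B)"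
          using g_le[OF u(3)] p by (intro mult_nonneg_nonneg) (auto simp: g_def)
        ultimately show ?thesis by simp
      qed
      finally show "(v u \<bullet> v u - (1 + p) / u * g - P) * (1 / u) + (- 1 / u\<^sup>2) * g
          + 3 / (2 * (1 + p)) * (- ((1 + p) / u * (v u \<bullet> v u))) + \<epsilon> * (1 / u) + (2 + p) * B * (- 1 / u\<^sup>2) \<le> 0" .
    qed
    then have ln_le: "\<epsilon> * ln t \<le> Z s + B" if "s \<le> t" for t
    proof -
      have t: "1 \<le> t" using that s by simp
      have "- B \<le> (v t \<bullet> (x t - c)) * (1 / t)"
      proof -
        have "- B * 1 \<le> - B * (1 / t)" using t B by (intro mult_left_mono_neg) auto
        also have "\<dots> \<le> (v t \<bullet> (x t - c)) * (1 / t)" using g_le[OF that] t by (intro mult_right_mono) auto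
        finally show ?thesis by simp
      qed
      moreover have "0 \<le> 3 / (2 * (1 + p)) * en t" "0 \<le> (2 + p) * B * (1 / t)"
        using p en_nonneg[of t] B t by auto
      ultimately show ?thesis using \<open>s \<le> t \<Longrightarrow> Z t \<le> Z s\<close>[OF that] unfolding Z_def[of t] by linarith
    qed
    define t where "t = max s (exp ((Z s + B) / \<epsilon> + 1))"
    have "(Z s + B) / \<epsilon> + 1 \<le> ln t" unfolding t_def using s by (subst ln_ge_iff) auto
    then have "Z s + B < \<epsilon> * ln t" using \<epsilon> by (simp add: field_simps)
    then show False using ln_le[of t] by (simp add: t_def)
  qed
  then obtain T where "s \<le> T" "en T < \<epsilon>" by auto
  then have "\<And>t. T \<le> t \<Longrightarrow> en t < \<epsilon>" using en_antimono s by (meson le_less_trans less_le_trans)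
  then show "\<forall>\<^sub>F t in at_top. dist (en t) 0 < \<epsilon>"
    unfolding eventually_at_top_linorder using en_nonneg by (auto intro!: exI[of _ T])
qed

text \<open>Outside \<open>S\<close>, on the compact sublevel set that holds the trajectory,
  \<open>F\<close> has a minimum above \<open>m\<close>, which the vanishing energy eventually
  undercuts.\<close>

lemma eventually_in_open:
  assumes "open S" "X \<subseteq> S"
  shows "\<forall>\<^sub>F t in at_top. x t \<in> S"
proof -
  define s where "s = t0 + 1"
  have s: "t0 < s" by (simp add: s_def)
  define K where "K = {y. F y \<le> m + en s} - S"
  have K: "compact K" unfolding K_def using compact_sublevel assms by (intro compact_diff)
  have xK: "x t \<in> S \<or> x t \<in> K" if "s \<le> t" for t using F_bounded[OF s that] by (auto simp: K_def)
  show ?thesis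
  proof (cases "K = {}")
    case True
    then show ?thesis using xK unfolding eventually_at_top_linorder by auto
  next
    case False
    obtain y where y: "y \<in> K" "\<And>z. z \<in> K \<Longrightarrow> F y \<le> F z"
      using continuous_attains_inf[OF K False] continuous_F continuous_on_subset by blast
    have "y \<notin> X" using y(1) assms by (auto simp: K_def)
    then have "m < F y" using min[of y] by (auto simp: X_def)
    then have "\<forall>\<^sub>F t in at_top. en t < F y - m" using en_tendsto_0 by (intro order_tendstoD) auto
    moreover have "\<forall>\<^sub>F t in at_top. s \<le> t" by (rule eventually_ge_at_top)
    ultimately show ?thesis
    proof eventually_elim
      case (elim t)
      then have "F (x t) < F y" using W_le_en[of t] by (simp add: W_def)
      then show ?case using xK[of t] y(2)[of "x t"] elim by auto
    qed
  qed
qed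

lemma x_continuous: "t0 < t \<Longrightarrow> isCont x t"
  using x_deriv has_vector_derivative_continuous by blast

lemma tg_small:
  assumes "(e \<longlongrightarrow> 0) at_top" "0 < \<eta>"
  shows "\<forall>\<^sub>F t in at_top. \<forall>c\<in>X. \<bar>t * (v t \<bullet> (x t - c))\<bar> < \<eta>"
proof -
  obtain R where R: "0 < R" "\<And>c t. c \<in> X \<Longrightarrow> t0 + 1 \<le> t \<Longrightarrow> norm (x t - c) \<le> R"
    using x_bounded[of "t0 + 1"] by auto
  have "((\<lambda>t. sqrt (2 * e t) * R) \<longlongrightarrow> sqrt (2 * 0) * R) at_top"
    by (intro tendsto_intros assms)
  then have "\<forall>\<^sub>F t in at_top. sqrt (2 * e t) * R < \<eta>" using assms(2) by (intro order_tendstoD) auto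
  moreover have "\<forall>\<^sub>F t in at_top. t0 + 1 \<le> t" by (rule eventually_ge_at_top)
  ultimately show ?thesis
  proof eventually_elim
    case (elim t)
    show ?case
    proof
      fix c assume "c \<in> X"
      have "\<bar>t * (v t \<bullet> (x t - c))\<bar> \<le> sqrt (2 * e t) * norm (x t - c)" using elim t0 by (intro tg_le) simp
      also have "\<dots> \<le> sqrt (2 * e t) * R"
        using R(2)[OF \<open>c \<in> X\<close>] elim e_nonneg by (intro mult_left_mono) auto
      finally show "\<bar>t * (v t \<bullet> (x t - c))\<bar> < \<eta>" using elim by simp
    qed
  qed
qed

lemma E_small:
  assumes "(e \<longlongrightarrow> 0) at_top" "0 < \<eta>"
  shows "\<forall>\<^sub>F t in at_top. \<forall>c\<in>X. \<bar>E c t\<bar> < \<eta>"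
proof -
  have "\<forall>\<^sub>F t in at_top. e t < \<eta> / 2" using assms by (intro order_tendstoD) auto
  moreover have "\<forall>\<^sub>F t in at_top. \<forall>c\<in>X. \<bar>t * (v t \<bullet> (x t - c))\<bar> < \<eta> / p"
    using assms p by (intro tg_small) auto
  ultimately show ?thesis
  proof eventually_elim
    case (elim t)
    show ?case
    proof
      fix c assume "c \<in> X"
      then have "p / 2 * \<bar>t * (v t \<bullet> (x t - c))\<bar> < \<eta> / 2" using elim p by (simp add: field_simps)
      moreover have "\<bar>E c t\<bar> \<le> e t + p / 2 * \<bar>t * (v t \<bullet> (x t - c))\<bar>"
        unfolding E_def using e_nonneg[of t] p by (intro order_trans[OF abs_triangle_ineq]) (simp add: abs_mult)
      ultimately show "\<bar>E c t\<bar> < \<eta>" using elim by simp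
    qed
  qed
qed

text \<open>Since \<open>en\<close> decreases, the integral of \<open>e r / r = r * en r\<close>
  over \<open>{t / 2..t}\<close> is at least \<open>3 / 8 * e t\<close>; convergence of the whole
  integral forces these pieces to zero.\<close>

lemma e_tendsto_0_if_integrable:
  assumes "\<And>t. s < t \<Longrightarrow> (N has_real_derivative e t / t) (at t)" "t0 < s"
    and "\<And>t. s < t \<Longrightarrow> N t \<le> B"
  shows "(e \<longlongrightarrow> 0) at_top"
proof (rule tendstoI)
  fix \<epsilon> :: real assume \<epsilon>: "0 < \<epsilon>"
  have N_mono: "N t \<le> N u" if "s < t" "t \<le> u" for t u
  proof (rule DERIV_nonneg_imp_nondecreasing[OF that(2)])
    fix r assume "t \<le> r"
    then show "\<exists>y. (N has_real_derivative y) (at r) \<and> 0 \<le> y"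
      using assms(1)[of r] that e_nonneg[of r] assms(2) t0 by (intro exI[of _ "e r / r"]) auto
  qed
  define L where "L = (SUP t\<in>{s<..}. N t)"
  have bdd: "bdd_above (N ` {s<..})" using assms(3) by (intro bdd_aboveI2[of _ _ B]) auto
  have "\<exists>T\<in>{s<..}. L - 3 / 8 * \<epsilon> < N T"
    using \<epsilon> less_cSUP_iff[OF _ bdd, of "L - 3 / 8 * \<epsilon>"] unfolding L_def by auto
  then obtain T where T: "s < T" "L - 3 / 8 * \<epsilon> < N T" by auto
  have "e t < \<epsilon>" if t: "2 * T \<le> t" for t
  proof -
    define h where "h = t / 2"
    have h: "T \<le> h" "s < h" "0 < h" "h \<le> t" "t = 2 * h" using t T assms(2) t0 by (auto simp: h_def)
    have "N h - en t * h\<^sup>2 / 2 \<le> N t - en t * t\<^sup>2 / 2"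
    proof (rule DERIV_nonneg_imp_nondecreasing[OF h(4)])
      fix r assume r: "h \<le> r" "r \<le> t"
      then have "en t \<le> en r" using h assms(2) by (intro en_antimono) auto
      then have "0 \<le> r * (en r - en t)" using r h by simp
      also have "\<dots> = e r / r - en t * r" using r h by (simp add: e_def power2_eq_square algebra_simps)
      finally have "0 \<le> e r / r - en t * r" .
      moreover have "((\<lambda>r. N r - en t * r\<^sup>2 / 2) has_real_derivative e r / r - en t * r) (at r)"
        using r h by (intro DERIV_diff assms(1)) (auto intro!: derivative_eq_intros)
      ultimately show "\<exists>y. ((\<lambda>r. N r - en t * r\<^sup>2 / 2) has_real_derivative y) (at r) \<and> 0 \<le> y" by blast
    qed
    moreover have "N t \<le> L" unfolding L_def using h by (intro cSUP_upper bdd) auto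
    moreover have "N T \<le> N h" using N_mono T h by simp
    moreover have "en t * t\<^sup>2 / 2 - en t * h\<^sup>2 / 2 = 3 / 8 * e t"
      by (simp add: e_def h_def power2_eq_square field_simps)
    ultimately show ?thesis using T(2) by linarith
  qed
  then show "\<forall>\<^sub>F t in at_top. dist (e t) 0 < \<epsilon>"
    unfolding eventually_at_top_linorder using e_nonneg by (auto intro!: exI[of _ "2 * T"])
qed

section \<open>Convergence to a single minimizer\<close>

lemma accumulation_point:
  obtains xb where "xb \<in> X" "\<And>\<rho> T. 0 < \<rho> \<Longrightarrow> \<exists>t\<ge>T. norm (x t - xb) < \<rho>"
proof -
  define s where "s = t0 + 1"
  have s: "t0 < s" by (simp add: s_def)
  have "\<forall>n. x (s + real n) \<in> {y. F y \<le> m + en s}" using F_bounded[OF s] by simp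
  then obtain xb r where r: "strict_mono r" "((\<lambda>n. x (s + real n)) \<circ> r) \<longlonglongrightarrow> xb"
    using compact_sublevel unfolding compact_def by metis
  have at_top: "filterlim (\<lambda>n. s + real (r n)) at_top sequentially"
    by (intro filterlim_tendsto_add_at_top[OF tendsto_const]
        filterlim_compose[OF filterlim_real_sequentially] filterlim_subseq r)
  have "(\<lambda>n. W (s + real (r n))) \<longlonglongrightarrow> 0"
  proof (rule tendsto_sandwich[OF _ _ tendsto_const])
    show "(\<lambda>n. en (s + real (r n))) \<longlonglongrightarrow> 0" by (rule filterlim_compose[OF en_tendsto_0 at_top])
  qed (auto simp: W_nonneg W_le_en)
  moreover have "(\<lambda>n. W (s + real (r n))) \<longlonglongrightarrow> F xb - m"
    unfolding W_def using r(2) continuous_F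
    by (intro tendsto_intros) (auto simp: o_def continuous_on_eq_continuous_at intro!: isCont_tendsto_compose[of _ F])
  ultimately have "F xb - m = 0" using LIMSEQ_unique by blast
  then have "xb \<in> X" by (simp add: X_def)
  moreover have "\<exists>t\<ge>T. norm (x t - xb) < \<rho>" if "0 < \<rho>" for \<rho> T
  proof -
    have "\<forall>\<^sub>F n in sequentially. dist (x (s + real (r n))) xb < \<rho>"
      using tendstoD[OF r(2) that] by (simp add: o_def)
    moreover have "\<forall>\<^sub>F n in sequentially. T \<le> s + real (r n)"
      using at_top by (simp add: filterlim_at_top)
    ultimately have "\<forall>\<^sub>F n in sequentially. dist (x (s + real (r n))) xb < \<rho> \<and> T \<le> s + real (r n)"
      by (rule eventually_conj)
    then show ?thesis using eventually_happens'[of sequentially] by (force simp: dist_norm)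
  qed
  ultimately show ?thesis using that by blast
qed

text \<open>\<open>Q\<close> is \<open>p / 2\<close> times the least power distance of
  \<open>x t\<close> to finitely many balls on which flatness holds. \<open>min_barrier\<close>
  makes \<open>Q + N\<close> nearly nonincreasing: boundedness of \<open>Q\<close> then gives
  integrability of \<open>e t / t\<close>, hence \<open>e\<close> and all \<open>E c\<close> vanish,
  and with that \<open>x\<close> cannot leave a neighborhood of an accumulation point.\<close>

lemma trajectory_converges:
  obtains xb where "xb \<in> X" "(x \<longlongrightarrow> xb) at_top" "(e \<longlongrightarrow> 0) at_top"
proof -
  obtain xb where xb: "xb \<in> X" "\<And>\<rho> T. 0 < \<rho> \<Longrightarrow> \<exists>t\<ge>T. norm (x t - xb) < \<rho>"
    using accumulation_point by blast
  have "\<exists>r>0. (\<forall>y\<in>ball c r. \<gamma> * (F y - m) \<le> G y \<bullet> (y - c)) \<and> (c \<noteq> xb \<longrightarrow> 2 * r \<le> norm (c - xb))"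
    if "c \<in> X" for c
  proof -
    obtain \<eta> where "0 < \<eta>" "\<forall>y\<in>ball c \<eta>. \<gamma> * (F y - m) \<le> G y \<bullet> (y - c)"
      using flat[OF \<open>c \<in> X\<close>] by blast
    then show ?thesis
      by (intro exI[of _ "if c = xb then \<eta> else min \<eta> (norm (c - xb) / 2)"]) auto
  qed
  then obtain rad where rad: "\<And>c. c \<in> X \<Longrightarrow> 0 < rad c"
      "\<And>c y. c \<in> X \<Longrightarrow> y \<in> ball c (rad c) \<Longrightarrow> \<gamma> * (F y - m) \<le> G y \<bullet> (y - c)"
      "\<And>c. c \<in> X \<Longrightarrow> c \<noteq> xb \<Longrightarrow> 2 * rad c \<le> norm (c - xb)"
    by metis
  \<comment> \<open>Near \<open>xb\<close> the branch of \<open>xb\<close> is the active one, because the other balls stay away from \<open>xb\<close>.\<close>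
  obtain I' where I': "I' \<subseteq> X" "finite I'" "X \<subseteq> (\<Union>c\<in>I'. ball c (rad c))"
    using compactE_image[OF compact_X, of X "\<lambda>c. ball c (rad c)"] rad(1) by (metis (no_types, lifting) UN_iff centre_in_ball open_ball subsetI)
  define I where "I = insert xb I'"
  have I: "finite I" "I \<noteq> {}" "I \<subseteq> X" "xb \<in> I" using I' xb by (auto simp: I_def)
  define S where "S = (\<Union>c\<in>I. ball c (rad c))"
  have "open S" "X \<subseteq> S" using I' by (auto simp: S_def I_def)
  then obtain T0' where T0': "\<And>t. T0' \<le> t \<Longrightarrow> x t \<in> S"
    using eventually_in_open unfolding eventually_at_top_linorder by blast
  define s where "s = t0 + 1"
  define T0 where "T0 = max (s + 1) T0'"
  have s: "t0 < s" by (simp add: s_def)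
  have T0: "s < T0" "T0' \<le> T0" by (auto simp: T0_def)
  have "continuous_on {s..} (\<lambda>t. e t / t)"
    unfolding e_def using s t0 by (intro continuous_intros continuous_en) auto
  then obtain N where N: "\<And>t. s < t \<Longrightarrow> (N has_real_derivative e t / t) (at t)"
    using antiderivative_exists by blast
  have N_mono: "N t \<le> N u" if "s < t" "t \<le> u" for t u
  proof (rule DERIV_nonneg_imp_nondecreasing[OF that(2)])
    fix r assume "t \<le> r"
    then show "\<exists>y. (N has_real_derivative y) (at r) \<and> 0 \<le> y"
      using N[of r] that e_nonneg[of r] s t0 by (intro exI[of _ "e r / r"]) auto
  qed
  define h where "h c t = ((x t - c) \<bullet> (x t - c)) / 2 - (rad c)\<^sup>2 / 2" for c t
  define Y where "Y c t = p / 2 * h c t + N t" for c t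
  define Q where "Q t = Min ((\<lambda>c. Y c t) ` I) - N t" for t
  have Y_der: "(Y c has_real_derivative E c t / t) (at t)" if "s < t" for c t
  proof -
    have t: "t0 < t" "0 < t" using that s t0 by auto
    have "(Y c has_real_derivative p / 2 * (v t \<bullet> (x t - c) - 0) + e t / t) (at t)"
      unfolding Y_def h_def by (intro DERIV_add DERIV_cmult DERIV_diff f_deriv N DERIV_const t that)
    then show ?thesis by (rule DERIV_cong) (use t in \<open>simp add: E_def field_simps\<close>)
  qed
  \<comment> \<open>A point is inside a ball exactly if its power distance is negative. Some ball
    contains \<open>x t\<close>, so the least power distance is negative and the active ball
    contains \<open>x t\<close> too.\<close>
  have in_ball: "x t \<in> ball c (rad c)" if "T0 \<le> t" "c \<in> I" "Y c t = Min ((\<lambda>c. Y c t) ` I)" for c t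
  proof -
    have "x t \<in> S" using that T0 by (intro T0') simp
    then obtain d where d: "d \<in> I" "x t \<in> ball d (rad d)" by (auto simp: S_def)
    have "Y c t \<le> Y d t" unfolding that(3) using d I by (intro Min_le) auto
    then have "h c t \<le> h d t" using p by (simp add: Y_def)
    also have "h d t = ((norm (x t - d))\<^sup>2 - (rad d)\<^sup>2) / 2" by (simp add: h_def power2_norm_eq_inner diff_divide_distrib)
    also have "\<dots> < 0" using d by (simp add: dist_norm norm_minus_commute power_strict_mono)
    finally have "(norm (x t - c))\<^sup>2 < (rad c)\<^sup>2" by (simp add: h_def power2_norm_eq_inner)
    moreover have "0 < rad c" using rad(1) that I by auto
    ultimately show ?thesis using power_less_imp_less_base[of "norm (x t - c)" 2 "rad c"]
      by (simp add: dist_norm norm_minus_commute)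
  qed
  \<comment> \<open>Continuity keeps \<open>x\<close> in the active ball slightly before any given
    time, where \<open>J c\<close> decreases; this is the local hypothesis of
    \<open>min_barrier\<close>. The slope \<open>T powr p * \<eta>\<close> and the factor
    \<open>T powr (- p)\<close> combine to the uniform error \<open>\<eta> / p\<close>.\<close>
  have Q_step: "Q t + N t \<le> Q T + N T + \<eta> / p"
    if T: "T0 \<le> T" "T \<le> t" and \<eta>: "\<And>c. c \<in> I \<Longrightarrow> \<bar>E c T\<bar> < \<eta>" for t T \<eta>
  proof -
    have Tpos: "0 < T" "s < T" using T T0 s t0 by auto
    have "Min ((\<lambda>c. Y c T) ` I) \<in> (\<lambda>c. Y c T) ` I" using I by (intro Min_in) auto
    then obtain c0 where c0: "c0 \<in> I" "Y c0 T = Min ((\<lambda>c. Y c T) ` I)" by auto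
    have J_eq: "u powr (p + 1) * (E c u / u) = J c u" if "0 < u" for c u
      using that by (simp add: J_def powr_add)
    have "Min ((\<lambda>c. Y c t) ` I) \<le> Min ((\<lambda>c. Y c T) ` I) + (T powr p * \<eta>) / p * (T powr (- p) - t powr (- p))"
    proof (rule min_barrier[where Y = Y and D = "\<lambda>c t. E c t / t", OF I(1,2) p Tpos(1) _ _ c0 _ T(2)])
      show "(Y c has_real_derivative E c u / u) (at u)" if "T \<le> u" for c u
        using Y_der that Tpos by simp
      have "J c0 T < T powr p * \<eta>" unfolding J_def using \<eta>[OF c0(1)] Tpos by simp
      then show "T powr (p + 1) * (E c0 T / T) < T powr p * \<eta>" using J_eq Tpos by simp
      fix c u assume c: "c \<in> I" "T < u" "Y c u = Min ((\<lambda>c. Y c u) ` I)"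
      then have u: "s < u" "T0 \<le> u" "t0 < u" using Tpos T s by auto
      have "x u \<in> ball c (rad c)" using in_ball c u by blast
      then have "\<forall>\<^sub>F w in at u. x w \<in> ball c (rad c)"
        using x_continuous[OF u(3)] unfolding isCont_def by (intro topological_tendstoD) auto
      then obtain d where d: "0 < d" "\<And>w. w \<noteq> u \<Longrightarrow> dist w u < d \<Longrightarrow> x w \<in> ball c (rad c)"
        by (auto simp: eventually_at)
      define u' where "u' = max T (u - d / 2)"
      have "u powr (p + 1) * (E c u / u) \<le> w powr (p + 1) * (E c w / w)" if w: "w \<in> {u'..u}" for w
      proof -
        have "J c u \<le> J c w"
        proof (rule J_antimono)
          fix z assume "w \<le> z" "z \<le> u"
          then have "x z \<in> ball c (rad c)" using w d(2)[of z] \<open>x u \<in> ball c (rad c)\<close> d(1)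
            by (cases "z = u") (auto simp: u'_def dist_real_def)
          then show "\<gamma> * W z \<le> G (x z) \<bullet> (x z - c)" using rad(2) c I by (auto simp: W_def)
        qed (use w Tpos s in \<open>auto simp: u'_def\<close>)
        moreover have "0 < w" "0 < u" using w Tpos c by (auto simp: u'_def)
        ultimately show ?thesis by (simp only: J_eq)
      qed
      then show "\<exists>u'\<ge>T. u' < u \<and> (\<forall>w\<in>{u'..u}. u powr (p + 1) * (E c u / u) \<le> w powr (p + 1) * (E c w / w))"
        using d c by (intro exI[of _ u']) (auto simp: u'_def)
    qed
    moreover have "(T powr p * \<eta>) / p * (T powr (- p) - t powr (- p)) \<le> \<eta> / p"
    proof -
      have "0 < \<eta>" using \<eta>[OF c0(1)] by linarith
      then have "T powr p * \<eta> / p * (T powr (- p) - t powr (- p)) \<le> T powr p * \<eta> / p * T powr (- p)"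
        using p by (intro mult_left_mono) auto
      also have "\<dots> = \<eta> / p" using Tpos by (simp add: powr_minus)
      finally show ?thesis .
    qed
    ultimately show ?thesis by (simp add: Q_def)
  qed
  have Q_eq: "\<exists>c\<in>I. Q t = p / 2 * h c t" for t
  proof -
    have "Min ((\<lambda>c. Y c t) ` I) \<in> (\<lambda>c. Y c t) ` I" using I by (intro Min_in) auto
    then show ?thesis by (auto simp: Q_def Y_def)
  qed
  have Q_le: "Q t \<le> p / 2 * h c t" if "c \<in> I" for c t
  proof -
    have "Min ((\<lambda>c. Y c t) ` I) \<le> Y c t" using I that by (intro Min_le) auto
    then show ?thesis by (simp add: Q_def Y_def)
  qed
  define R where "R = Max (rad ` I)"
  have R: "rad c \<le> R" if "c \<in> I" for c unfolding R_def using that I by simp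
  have Q_ge: "- (p / 2 * (R\<^sup>2 / 2)) \<le> Q t" for t
  proof -
    obtain c where c: "c \<in> I" "Q t = p / 2 * h c t" using Q_eq by blast
    have "(rad c)\<^sup>2 \<le> R\<^sup>2" using R[OF c(1)] rad(1) c I by (intro power_mono) (auto simp: less_imp_le)
    then have "- (R\<^sup>2 / 2) \<le> h c t" unfolding h_def using inner_ge_zero[of "x t - c"] by linarith
    then have "p / 2 * (- (R\<^sup>2 / 2)) \<le> p / 2 * h c t" using p by (intro mult_left_mono) auto
    then show ?thesis using c by simp
  qed
  have e_lim: "(e \<longlongrightarrow> 0) at_top"
  proof -
    define \<eta> where "\<eta> = Max ((\<lambda>c. \<bar>E c T0\<bar>) ` I) + 1"
    have \<eta>: "\<bar>E c T0\<bar> < \<eta>" if "c \<in> I" for c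
    proof -
      have "\<bar>E c T0\<bar> \<le> Max ((\<lambda>c. \<bar>E c T0\<bar>) ` I)" using that I by (intro Max_ge) auto
      then show ?thesis by (simp add: \<eta>_def)
    qed
    define B where "B = p / 2 * (R\<^sup>2 / 2) + Q T0 + N T0 + \<eta> / p"
    have "N t \<le> B" if "T0 \<le> t" for t
      using Q_step[OF order_refl that \<eta>] Q_ge[of t] by (simp add: B_def)
    then have "N t \<le> B" if "s < t" for t
      using that N_mono[of t T0] by (cases "T0 \<le> t") force+
    then show ?thesis using e_tendsto_0_if_integrable[OF N s] by blast
  qed
  moreover have "(x \<longlongrightarrow> xb) at_top"
  proof -
    define \<rho>0 where "\<rho>0 = Min (rad ` I)"
    have \<rho>0: "0 < \<rho>0" "\<And>c. c \<in> I \<Longrightarrow> \<rho>0 \<le> rad c" unfolding \<rho>0_def using I rad(1) by (auto simp: Min_gr_iff)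
    have near: "\<exists>T. \<forall>t\<ge>T. norm (x t - xb) < \<rho>" if \<rho>: "0 < \<rho>" "\<rho> < \<rho>0" for \<rho>
    proof -
      \<comment> \<open>Then \<open>\<eta> / p = p / 2 * (\<rho>\<^sup>2 / 8)\<close>, so the
        squared distance to \<open>xb\<close> grows by at most \<open>\<rho>\<^sup>2 / 4\<close>:
        too little to get from below \<open>\<rho> / 2\<close> up to \<open>\<rho>\<close>.\<close>
      define \<eta> where "\<eta> = p\<^sup>2 * \<rho>\<^sup>2 / 16"
      have \<eta>: "0 < \<eta>" using p \<rho> by (simp add: \<eta>_def)
      obtain T1 where T1: "\<And>t c. T1 \<le> t \<Longrightarrow> c \<in> X \<Longrightarrow> \<bar>E c t\<bar> < \<eta>"
        using E_small[OF e_lim \<eta>] unfolding eventually_at_top_linorder by blast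
      obtain T where T: "max T0 T1 \<le> T" "norm (x T - xb) < \<rho> / 2" using xb(2)[of "\<rho> / 2" "max T0 T1"] \<rho> by auto
      \<comment> \<open>On this sphere \<open>x t\<close> is outside all balls not centered at
        \<open>xb\<close>, so \<open>Q t\<close> is the branch of \<open>xb\<close>; at time
        \<open>T\<close> that branch is an upper bound for \<open>Q T\<close>.\<close>
      have no_crossing: "norm (x t - xb) \<noteq> \<rho>" if "T \<le> t" for t
      proof
        assume eq: "norm (x t - xb) = \<rho>"
        have "h xb t \<le> h c t" if "c \<in> I" for c
        proof (cases "c = xb")
          case False
          have "2 * rad c \<le> norm (c - xb)" using rad(3) False that I by auto
          also have "\<dots> \<le> norm (x t - c) + norm (x t - xb)"
            using norm_triangle_ineq4[of "x t - xb" "x t - c"] by simp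
          finally have "rad c \<le> norm (x t - c)" using eq \<rho> \<rho>0(2)[OF that] by simp
          then have "(rad c)\<^sup>2 \<le> (norm (x t - c))\<^sup>2" using rad(1) that I by (intro power_mono) (auto simp: less_imp_le)
          moreover have "(norm (x t - xb))\<^sup>2 \<le> (rad xb)\<^sup>2" using eq \<rho> \<rho>0(2)[OF I(4)] by (intro power_mono) auto
          ultimately show ?thesis by (simp add: h_def power2_norm_eq_inner)
        qed simp
        then have "p / 2 * h xb t \<le> Q t" using Q_eq[of t] p by (auto simp: mult_left_mono)
        also have "\<dots> \<le> Q T + \<eta> / p"
          using Q_step[of T t \<eta>] T T1 I N_mono[of T t] T0 that by fastforce
        also have "\<dots> \<le> p / 2 * h xb T + \<eta> / p" using Q_le[OF I(4)] by simp
        finally have "p / 2 * (h xb t - h xb T) \<le> p / 2 * (\<rho>\<^sup>2 / 8)"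
          using p by (simp add: \<eta>_def power2_eq_square field_simps)
        then have "h xb t - h xb T \<le> \<rho>\<^sup>2 / 8" using p by simp
        then have "\<rho>\<^sup>2 - (norm (x T - xb))\<^sup>2 \<le> \<rho>\<^sup>2 / 4"
          unfolding h_def power2_norm_eq_inner eq[symmetric] by (simp add: field_simps)
        moreover have "(norm (x T - xb))\<^sup>2 < (\<rho> / 2)\<^sup>2" using T by (intro power_strict_mono) auto
        moreover have "(\<rho> / 2)\<^sup>2 = \<rho>\<^sup>2 / 4" by (simp add: power2_eq_square)
        ultimately have "\<rho>\<^sup>2 < \<rho>\<^sup>2 / 2" by linarith
        then show False using \<rho> by simp
      qed
      have "norm (x t - xb) < \<rho>" if Tt: "T \<le> t" for t
      proof (rule ccontr)
        assume "\<not> ?thesis"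
        moreover have "continuous_on {T..t} (\<lambda>t. norm (x t - xb))"
          using T T0 s by (intro continuous_intros continuous_at_imp_continuous_on) (auto intro: x_continuous)
        ultimately obtain u where "T \<le> u" "norm (x u - xb) = \<rho>"
          using IVT'[of "\<lambda>t. norm (x t - xb)" T \<rho> t] T Tt \<rho> by auto
        then show False using no_crossing by blast
      qed
      then show ?thesis by blast
    qed
    show ?thesis
    proof (rule tendstoI)
      fix \<epsilon> :: real assume "0 < \<epsilon>"
      then have "0 < min \<epsilon> (\<rho>0 / 2)" "min \<epsilon> (\<rho>0 / 2) < \<rho>0" using \<rho>0(1) by linarith+
      then obtain T where "\<forall>t\<ge>T. norm (x t - xb) < min \<epsilon> (\<rho>0 / 2)"
        using near by blast
      then show "\<forall>\<^sub>F t in at_top. dist (x t) xb < \<epsilon>"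
        unfolding eventually_at_top_linorder by (auto simp: dist_norm)
    qed
  qed
  ultimately show ?thesis using that xb(1) by blast
qed

end

section \<open>Rate for friction of order 1/t\<close>

locale critical_flow_limit = critical_flow +
  fixes xb
  assumes xb: "xb \<in> X" and x_lim: "(x \<longlongrightarrow> xb) at_top" and e_lim: "(e \<longlongrightarrow> 0) at_top"
begin

text \<open>The decay exponent of \<open>e\<close>: \<open>p2 + 2 = 2 / (1 - q)\<close> is the one
  wanted for \<open>W\<close>.\<close>

definition p2 where "p2 = 2 * q / (1 - q)"

lemma p2: "0 < p2" "p2 \<le> p" using q pq by (auto simp: p2_def)

lemma flat_eventually: "\<forall>\<^sub>F t in at_top. \<gamma> * W t \<le> G (x t) \<bullet> (x t - xb)"
proof -
  obtain \<eta> where \<eta>: "0 < \<eta>" "\<forall>y\<in>ball xb \<eta>. \<gamma> * (F y - m) \<le> G y \<bullet> (y - xb)"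
    using flat[OF xb] by blast
  have "\<forall>\<^sub>F t in at_top. dist (x t) xb < \<eta>" using x_lim \<eta>(1) by (rule tendstoD)
  then show ?thesis by (rule eventually_mono) (use \<eta>(2) in \<open>auto simp: W_def dist_commute\<close>)
qed

text \<open>Linearity splits the inner product into \<open>(1 - \<mu>) * P + \<mu> * Q\<close> with
  \<open>Q\<close> nonnegative by convexity. Flatness at \<open>xb\<close> is spent on the part
  \<open>(1 - 2 * \<mu>) * P\<close> only, which leaves \<open>- \<mu> * P\<close> as a spare
  negative term.\<close>

lemma homothetic_center:
  assumes "z \<in> X" "0 \<le> \<mu>" "\<mu> \<le> 1 / 2" "\<gamma> * W t \<le> G (x t) \<bullet> (x t - xb)"
  shows "(2 + p) * W t - p / 2 * (G (x t) \<bullet> (x t - (xb + \<mu> *\<^sub>R (z - xb))))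
    \<le> p / 2 * (2 * \<mu> * \<gamma> * W t - \<mu> * (G (x t) \<bullet> (x t - xb)))"
proof -
  define P where "P = G (x t) \<bullet> (x t - xb)"
  define Q where "Q = G (x t) \<bullet> (x t - z)"
  have "G (x t) \<bullet> (x t - (xb + \<mu> *\<^sub>R (z - xb))) = (1 - \<mu>) * P + \<mu> * Q"
    by (simp add: P_def Q_def inner_diff_right inner_add_right algebra_simps)
  then have "p / 2 * (G (x t) \<bullet> (x t - (xb + \<mu> *\<^sub>R (z - xb)))) = p / 2 * ((1 - \<mu>) * P) + p / 2 * (\<mu> * Q)"
    by (simp only: distrib_left)
  moreover have "0 \<le> p / 2 * (\<mu> * Q)"
    using center[OF assms(1), of t] W_nonneg[of t] assms(2) p by (simp add: Q_def)
  moreover have "(2 + p) * W t \<le> p / 2 * (\<gamma> * W t)"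
    using mult_right_mono[OF p\<gamma> W_nonneg[of t]] by (simp add: mult.assoc)
  moreover have "\<gamma> * W t - (1 - \<mu>) * P \<le> 2 * \<mu> * \<gamma> * W t - \<mu> * P"
  proof -
    have "(1 - 2 * \<mu>) * (\<gamma> * W t) \<le> (1 - 2 * \<mu>) * P"
      using assms by (intro mult_left_mono) (auto simp: P_def)
    then show ?thesis by (simp add: algebra_simps)
  qed
  then have "p / 2 * (\<gamma> * W t - (1 - \<mu>) * P) \<le> p / 2 * (2 * \<mu> * \<gamma> * W t - \<mu> * P)"
    using p by (intro mult_left_mono) auto
  then have "p / 2 * (\<gamma> * W t) - p / 2 * ((1 - \<mu>) * P) \<le> p / 2 * (2 * \<mu> * \<gamma> * W t - \<mu> * P)"
    by (simp only: right_diff_distrib)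
  ultimately show ?thesis unfolding P_def[symmetric] by linarith
qed

lemma homothetic_center_in: "z \<in> X \<Longrightarrow> 0 \<le> \<mu> \<Longrightarrow> \<mu> \<le> 1 \<Longrightarrow> xb + \<mu> *\<^sub>R (z - xb) \<in> X"
  using convexD[OF convex_X xb, of z "1 - \<mu>" \<mu>] by (simp add: algebra_simps)

text \<open>\<open>homothety_approx\<close> is applied to the minimizer \<open>c\<close> nearest to
  \<open>x t\<close>. It satisfies \<open>norm (c - xb) \<le> 2 * norm (x t - xb)\<close>, which is
  why the radius is halved; the two factors 2 in the estimate account for
  \<open>\<delta> / 8\<close>.\<close>

lemma homothetic_distance:
  assumes "0 < \<delta>"
  obtains \<rho> where "0 < \<rho>" "\<And>t \<mu>. 0 < \<mu> \<Longrightarrow> \<mu> \<le> 1 \<Longrightarrow> norm (x t - xb) \<le> \<rho> * \<mu> \<Longrightarrow>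
     \<exists>z\<in>X. (norm (x t - (xb + \<mu> *\<^sub>R (z - xb))))\<^sup>2 \<le> 2 * (infdist (x t) X)\<^sup>2 + \<delta> * (norm (x t - xb))\<^sup>2"
proof -
  define \<delta>' where "\<delta>' = sqrt (\<delta> / 8)"
  have \<delta>': "0 < \<delta>'" "\<delta>'\<^sup>2 = \<delta> / 8" using assms by (auto simp: \<delta>'_def)
  obtain \<rho> where \<rho>: "0 < \<rho>"
    "\<And>c \<mu>. c \<in> X \<Longrightarrow> 0 < \<mu> \<Longrightarrow> \<mu> \<le> 1 \<Longrightarrow> norm (c - xb) \<le> \<rho> * \<mu> \<Longrightarrow>
       \<exists>z\<in>X. norm (c - (xb + \<mu> *\<^sub>R (z - xb))) \<le> \<delta>' * norm (c - xb)"
    using homothety_approx[OF convex_X xb compact_imp_bounded[OF compact_X] \<delta>'(1)] by blast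
  have "\<exists>z\<in>X. (norm (x t - (xb + \<mu> *\<^sub>R (z - xb))))\<^sup>2 \<le> 2 * (infdist (x t) X)\<^sup>2 + \<delta> * (norm (x t - xb))\<^sup>2"
    if \<mu>: "0 < \<mu>" "\<mu> \<le> 1" "norm (x t - xb) \<le> \<rho> / 2 * \<mu>" for t \<mu>
  proof -
    obtain c where c: "c \<in> X" "norm (x t - c) = infdist (x t) X" using nearest by blast
    have "infdist (x t) X \<le> norm (x t - xb)" using infdist_le[OF xb, of "x t"] by (simp add: dist_norm)
    then have c_xb: "norm (c - xb) \<le> 2 * norm (x t - xb)"
      using norm_triangle_ineq4[of "x t - xb" "x t - c"] c by simp
    then obtain z where z: "z \<in> X" "norm (c - (xb + \<mu> *\<^sub>R (z - xb))) \<le> \<delta>' * norm (c - xb)"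
      using \<rho>(2)[OF c(1) \<mu>(1,2)] \<mu>(3) by auto
    define y where "y = xb + \<mu> *\<^sub>R (z - xb)"
    define D where "D = norm (x t - xb)"
    define d where "d = infdist (x t) X"
    have "norm (c - y) \<le> \<delta>' * (2 * D)"
      unfolding y_def D_def by (rule order_trans[OF z(2)]) (use c_xb \<delta>' in \<open>intro mult_left_mono; simp\<close>)
    then have "norm (x t - y) \<le> d + \<delta>' * (2 * D)"
      using norm_triangle_ineq[of "x t - c" "c - y"] c by (simp add: d_def)
    then have "(norm (x t - y))\<^sup>2 \<le> (d + \<delta>' * (2 * D))\<^sup>2" by (intro power_mono) auto
    also have "\<dots> \<le> 2 * d\<^sup>2 + 2 * (\<delta>' * (2 * D))\<^sup>2"
      using sum_squares_bound[of d "\<delta>' * (2 * D)"] by (simp add: power2_sum)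
    also have "2 * (\<delta>' * (2 * D))\<^sup>2 = \<delta> * D\<^sup>2" by (simp add: power_mult_distrib \<delta>')
    finally show ?thesis using z(1) unfolding y_def d_def D_def by blast
  qed
  then show ?thesis using that[of "\<rho> / 2"] \<rho>(1) by simp
qed

lemma infdist_le_e:
  assumes "0 < \<epsilon>"
  obtains C where "0 < C" "\<And>t. t0 + 1 \<le> t \<Longrightarrow> (infdist (x t) X)\<^sup>2 \<le> \<epsilon> * e t + C * t powr (- p2)"
proof -
  obtain C where C: "0 < C" "\<And>t. t0 + 1 \<le> t \<Longrightarrow>
    t powr (- 0) * (infdist (x t) X)\<^sup>2 \<le> \<epsilon> * (t powr 2 * W t) + C * t powr (- ((0 + 2 * q) / (1 - q)))"
    using infdist_young[of "t0 + 1" \<epsilon> 0 2] assms by (metis less_add_one)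
  have "(infdist (x t) X)\<^sup>2 \<le> \<epsilon> * e t + C * t powr (- p2)" if "t0 + 1 \<le> t" for t
  proof -
    have "0 < t" using that t0 by simp
    then have "t powr 2 * W t \<le> e t" using W_le_e[of t] by simp
    then have "\<epsilon> * (t powr 2 * W t) \<le> \<epsilon> * e t" using assms by (intro mult_left_mono) auto
    then show ?thesis using C(2)[OF that] \<open>0 < t\<close> by (simp add: p2_def)
  qed
  then show ?thesis using that C(1) by blast
qed

text \<open>
  \<open>E c + (p^2/4) |x - c|^2 - (p/2) \<mu> (t <v, x - xb> + (p/2) |x - xb|^2)\<close> decreases to a nonnegative
  limit when \<open>c = xb + \<mu> (z - xb)\<close> and \<open>\<mu> = 1 / (2 \<gamma>)\<close>.
\<close>

lemma distance_le_center:
  obtains C T where "0 < C" "\<And>t z. T \<le> t \<Longrightarrow> z \<in> X \<Longrightarrow>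
    (norm (x t - xb))\<^sup>2 \<le> C * (e t + (norm (x t - (xb + (1 / (2 * \<gamma>)) *\<^sub>R (z - xb))))\<^sup>2)"
proof -
  define \<mu> where "\<mu> = 1 / (2 * \<gamma>)"
  have \<mu>: "0 < \<mu>" "\<mu> \<le> 1 / 2" "2 * \<mu> * \<gamma> = 1" using \<gamma> by (auto simp: \<mu>_def field_simps)
  obtain T' where T': "\<And>t. T' \<le> t \<Longrightarrow> \<gamma> * W t \<le> G (x t) \<bullet> (x t - xb)"
    using flat_eventually unfolding eventually_at_top_linorder by blast
  define T where "T = max (t0 + 1) T'"
  define f where "f c t = (x t - c) \<bullet> (x t - c) / 2" for c t
  define g where "g c t = t * (v t \<bullet> (x t - c))" for c t
  have V_ge: "p / 2 * \<mu> * (g xb t + p * f xb t) \<le> E c t + p\<^sup>2 / 2 * f c t"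
    if t: "T \<le> t" and z: "z \<in> X" and c: "c = xb + \<mu> *\<^sub>R (z - xb)" for t z c
  proof -
    define V where "V t = E c t + p\<^sup>2 / 2 * f c t - p / 2 * \<mu> * (g xb t + p * f xb t)" for t
    have V_mono: "V u \<le> V t" if "t \<le> u" for u
    proof (rule deriv_nonpos_antimono[OF that])
      fix r assume "t \<le> r"
      then have r: "t0 < r" "0 < r" "T' \<le> r" using t t0 by (auto simp: T_def)
      define P where "P = G (x r) \<bullet> (x r - xb)"
      define Pc where "Pc = G (x r) \<bullet> (x r - c)"
      show "(V has_real_derivative - (p / r * E c r) + r * ((2 + p) * W r - p / 2 * Pc)
          + p\<^sup>2 / 2 * (v r \<bullet> (x r - c))
          - p / 2 * \<mu> * (r * (v r \<bullet> v r) - p * (v r \<bullet> (x r - xb)) - r * P + p * (v r \<bullet> (x r - xb)))) (at r)"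
        unfolding V_def f_def g_def P_def Pc_def
        by (intro DERIV_diff DERIV_add DERIV_cmult E_deriv tg_deriv f_deriv r)
      have arith: "- A + B + C - M \<le> 0"
        if "B \<le> N" "A = Y + C" "w \<le> Y" "0 \<le> K" "N = w - n" "M = K - n" for A B C M N Y w K n :: real
        using that by linarith
      \<comment> \<open>As \<open>2 * \<mu> * \<gamma> = 1\<close>, the loss is
        \<open>p / 2 * W r\<close>, which the damping \<open>- (p / r) * e r\<close> absorbs. The
        term in \<open>\<mu> * P\<close> cancels against the derivative of
        \<open>g xb\<close>.\<close>
      have "(2 + p) * W r - p / 2 * Pc \<le> p / 2 * (W r - \<mu> * P)"
        using homothetic_center[OF z _ \<mu>(2) T'[OF r(3)]] \<mu> unfolding c Pc_def P_def by simp
      then have "r * ((2 + p) * W r - p / 2 * Pc) \<le> r * (p / 2 * (W r - \<mu> * P))"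
        using r by (intro mult_left_mono) auto
      moreover have "p / r * E c r = p / r * e r + p\<^sup>2 / 2 * (v r \<bullet> (x r - c))"
        using r by (simp add: E_def power2_eq_square field_simps)
      moreover have "r * (p / 2 * W r) \<le> p / r * e r"
      proof -
        have "p / r * (r\<^sup>2 * W r) \<le> p / r * e r" using p r W_le_e by (intro mult_left_mono) auto
        moreover have "p / r * (r\<^sup>2 * W r) = 2 * (r * (p / 2 * W r))" using r by (simp add: power2_eq_square)
        moreover have "0 \<le> r * (p / 2 * W r)" using r p W_nonneg[of r] by simp
        ultimately show ?thesis by linarith
      qed
      moreover have "0 \<le> p / 2 * \<mu> * (r * (v r \<bullet> v r))" using p \<mu> r by simp
      moreover have "r * (p / 2 * (W r - \<mu> * P)) = r * (p / 2 * W r) - p / 2 * \<mu> * (r * P)"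
        by (simp add: algebra_simps)
      moreover have "p / 2 * \<mu> * (r * (v r \<bullet> v r) - p * (v r \<bullet> (x r - xb)) - r * P + p * (v r \<bullet> (x r - xb)))
        = p / 2 * \<mu> * (r * (v r \<bullet> v r)) - p / 2 * \<mu> * (r * P)"
        by (simp add: algebra_simps)
      ultimately show "- (p / r * E c r) + r * ((2 + p) * W r - p / 2 * Pc)
          + p\<^sup>2 / 2 * (v r \<bullet> (x r - c))
          - p / 2 * \<mu> * (r * (v r \<bullet> v r) - p * (v r \<bullet> (x r - xb)) - r * P + p * (v r \<bullet> (x r - xb))) \<le> 0"
        by (rule arith)
    qed
    \<comment> \<open>At late times \<open>E c\<close>, \<open>g xb\<close> and \<open>f xb\<close>
      are arbitrarily small while \<open>f c\<close> is nonnegative, so a decreasing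
      \<open>V\<close> cannot be negative.\<close>
    have "0 \<le> V t"
    proof (rule field_le_epsilon)
      fix \<eta> :: real assume \<eta>: "0 < \<eta>"
      have cX: "c \<in> X" unfolding c using z \<mu> by (intro homothetic_center_in) auto
      have "((\<lambda>u. p / 2 * \<mu> * (\<eta> / (2 * p * \<mu>) + p * f xb u)) \<longlongrightarrow>
          p / 2 * \<mu> * (\<eta> / (2 * p * \<mu>) + p * ((xb - xb) \<bullet> (xb - xb) / 2))) at_top"
        unfolding f_def by (intro tendsto_intros x_lim) auto
      moreover have "p / 2 * \<mu> * (\<eta> / (2 * p * \<mu>) + p * ((xb - xb) \<bullet> (xb - xb) / 2)) < \<eta> / 2"
        using \<eta> p \<mu> by simp
      ultimately have 1: "\<forall>\<^sub>F u in at_top. p / 2 * \<mu> * (\<eta> / (2 * p * \<mu>) + p * f xb u) < \<eta> / 2"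
        by (intro order_tendstoD)
      have 2: "\<forall>\<^sub>F u in at_top. \<forall>c\<in>X. \<bar>u * (v u \<bullet> (x u - c))\<bar> < \<eta> / (2 * p * \<mu>)"
        using \<eta> p \<mu> by (intro tg_small e_lim) auto
      have 3: "\<forall>\<^sub>F u in at_top. \<forall>c\<in>X. \<bar>E c u\<bar> < \<eta> / 2" using \<eta> by (intro E_small e_lim) auto
      have 4: "\<forall>\<^sub>F u in at_top. t \<le> u" by (rule eventually_ge_at_top)
      obtain u where u: "p / 2 * \<mu> * (\<eta> / (2 * p * \<mu>) + p * f xb u) < \<eta> / 2"
          "\<forall>c\<in>X. \<bar>u * (v u \<bullet> (x u - c))\<bar> < \<eta> / (2 * p * \<mu>)" "\<forall>c\<in>X. \<bar>E c u\<bar> < \<eta> / 2" "t \<le> u"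
        using eventually_happens[OF eventually_conj[OF 1 eventually_conj[OF 2 eventually_conj[OF 3 4]]]] by auto
      have "g xb u \<le> \<eta> / (2 * p * \<mu>)" using u(2) xb unfolding g_def by fastforce
      then have "p / 2 * \<mu> * (g xb u + p * f xb u) \<le> p / 2 * \<mu> * (\<eta> / (2 * p * \<mu>) + p * f xb u)"
        using p \<mu> by (intro mult_left_mono) auto
      moreover have "- (\<eta> / 2) \<le> E c u" using u(3) cX by fastforce
      moreover have "0 \<le> p\<^sup>2 / 2 * f c u" by (simp add: f_def)
      ultimately have "- \<eta> \<le> V u" using u(1) unfolding V_def by linarith
      then show "0 \<le> V t + \<eta>" using V_mono[OF u(4)] by linarith
    qed
    then show ?thesis by (simp add: V_def)
  qed
  \<comment> \<open>The denominator is the coefficient of \<open>D\<^sup>2\<close> that survives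
    Young's inequality for \<open>s * D\<close>; the numerator majorizes the coefficients of both
    \<open>e t\<close> and \<open>d\<^sup>2\<close>.\<close>
  define C where "C = (1 + p + \<mu> + p\<^sup>2) / (p\<^sup>2 * \<mu> / 8)"
  have C: "0 < C" using p \<mu> by (auto simp: C_def intro!: divide_pos_pos add_pos_nonneg)
  have "(norm (x t - xb))\<^sup>2 \<le> C * (e t + (norm (x t - (xb + \<mu> *\<^sub>R (z - xb))))\<^sup>2)"
    if t: "T \<le> t" "z \<in> X" for t z
  proof -
    define c where "c = xb + \<mu> *\<^sub>R (z - xb)"
    define D where "D = norm (x t - xb)"
    define d where "d = norm (x t - c)"
    define s where "s = sqrt (2 * e t)"
    have s: "s\<^sup>2 = 2 * e t" using e_nonneg by (simp add: s_def)
    have "0 \<le> t" using t t0 by (simp add: T_def)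
    have gxb: "- (s * D) \<le> g xb t" using tg_le[OF \<open>0 \<le> t\<close>, of xb] by (simp add: g_def s_def D_def)
    have gc: "g c t \<le> s * d" using tg_le[OF \<open>0 \<le> t\<close>, of c] by (simp add: g_def s_def d_def)
    have sD: "s * D \<le> p * D\<^sup>2 / 4 + s\<^sup>2 / p"
    proof -
      have "0 \<le> (p * D / 2 - s)\<^sup>2 / p" using p by simp
      also have "\<dots> = p * D\<^sup>2 / 4 + s\<^sup>2 / p - s * D" using p by (simp add: power2_eq_square field_simps)
      finally show ?thesis by simp
    qed
    have sd: "s * d \<le> s\<^sup>2 / 2 + d\<^sup>2 / 2" using sum_squares_bound[of s d] by simp
    have fD: "f xb t = D\<^sup>2 / 2" "f c t = d\<^sup>2 / 2" by (auto simp: f_def D_def d_def power2_norm_eq_inner)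
    have "p / 2 * \<mu> * (g xb t + p * D\<^sup>2 / 2) \<le> e t + p / 2 * g c t + p\<^sup>2 / 4 * d\<^sup>2"
      using V_ge[OF t(1) t(2) c_def] unfolding fD E_def g_def[symmetric] by simp
    also have "\<dots> \<le> e t + p / 2 * (s\<^sup>2 / 2 + d\<^sup>2 / 2) + p\<^sup>2 / 4 * d\<^sup>2"
      using gc sd p by (intro add_right_mono add_left_mono mult_left_mono) auto
    finally have "p / 2 * \<mu> * (p * D\<^sup>2 / 4 - s\<^sup>2 / p) \<le> e t + p / 2 * (s\<^sup>2 / 2 + d\<^sup>2 / 2) + p\<^sup>2 / 4 * d\<^sup>2"
    proof (rule order_trans[rotated])
      have "p * D\<^sup>2 / 4 - s\<^sup>2 / p \<le> g xb t + p * D\<^sup>2 / 2" using gxb sD by linarith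
      then show "p / 2 * \<mu> * (p * D\<^sup>2 / 4 - s\<^sup>2 / p) \<le> p / 2 * \<mu> * (g xb t + p * D\<^sup>2 / 2)"
        using p \<mu> by (intro mult_left_mono) auto
    qed
    moreover have "p / 2 * \<mu> * (p * D\<^sup>2 / 4 - s\<^sup>2 / p) = p\<^sup>2 * \<mu> / 8 * D\<^sup>2 - \<mu> * e t"
      using p unfolding s by (simp add: power2_eq_square field_simps)
    ultimately have "p\<^sup>2 * \<mu> / 8 * D\<^sup>2 \<le> (1 + p / 2 + \<mu>) * e t + (p / 4 + p\<^sup>2 / 4) * d\<^sup>2"
      unfolding s by (simp add: algebra_simps)
    also have "\<dots> \<le> (1 + p + \<mu> + p\<^sup>2) * e t + (1 + p + \<mu> + p\<^sup>2) * d\<^sup>2"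
    proof (rule add_mono; rule mult_right_mono)
      show "1 + p / 2 + \<mu> \<le> 1 + p + \<mu> + p\<^sup>2" "p / 4 + p\<^sup>2 / 4 \<le> 1 + p + \<mu> + p\<^sup>2"
        using p \<mu> zero_le_power2[of p] by linarith+
    qed (simp_all add: e_nonneg)
    finally have "D\<^sup>2 \<le> C * (e t + d\<^sup>2)" using p \<mu> by (simp add: C_def field_simps)
    then show ?thesis by (simp add: D_def d_def c_def)
  qed
  then show ?thesis using that[of C T] C unfolding \<mu>_def by blast
qed

text \<open>The center in \<open>distance_le_center\<close> is chosen as close to \<open>x t\<close>
  as \<open>homothetic_distance\<close> allows. The error factor \<open>1 / (2 * C1)\<close> lets
  half of the squared distance be absorbed on the left, and growth bounds the distance to
  \<open>X\<close>.\<close>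

lemma distance_le_e:
  obtains C T where "0 < C" "\<And>t. T \<le> t \<Longrightarrow> (norm (x t - xb))\<^sup>2 \<le> C * (e t + t powr (- p2))"
proof -
  define \<mu> where "\<mu> = 1 / (2 * \<gamma>)"
  have \<mu>: "0 < \<mu>" "\<mu> \<le> 1" using \<gamma> by (auto simp: \<mu>_def field_simps)
  obtain C1 T1 where C1: "0 < C1" "\<And>t z. T1 \<le> t \<Longrightarrow> z \<in> X \<Longrightarrow>
    (norm (x t - xb))\<^sup>2 \<le> C1 * (e t + (norm (x t - (xb + \<mu> *\<^sub>R (z - xb))))\<^sup>2)"
    using distance_le_center unfolding \<mu>_def by blast
  obtain \<rho> where \<rho>: "0 < \<rho>" "\<And>t \<mu>. 0 < \<mu> \<Longrightarrow> \<mu> \<le> 1 \<Longrightarrow> norm (x t - xb) \<le> \<rho> * \<mu> \<Longrightarrow>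
     \<exists>z\<in>X. (norm (x t - (xb + \<mu> *\<^sub>R (z - xb))))\<^sup>2 \<le> 2 * (infdist (x t) X)\<^sup>2 + 1 / (2 * C1) * (norm (x t - xb))\<^sup>2"
    using homothetic_distance[of "1 / (2 * C1)"] C1(1) by auto
  obtain C2 where C2: "0 < C2" "\<And>t. t0 + 1 \<le> t \<Longrightarrow> (infdist (x t) X)\<^sup>2 \<le> 1 * e t + C2 * t powr (- p2)"
    using infdist_le_e[of 1] by auto
  have "\<forall>\<^sub>F t in at_top. dist (x t) xb < \<rho> * \<mu>" using \<mu> \<rho>(1) by (intro tendstoD[OF x_lim]) simp
  then obtain T2 where T2: "\<And>t. T2 \<le> t \<Longrightarrow> norm (x t - xb) \<le> \<rho> * \<mu>"
    unfolding eventually_at_top_linorder dist_norm by (meson less_imp_le)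
  define T where "T = max (t0 + 1) (max T1 T2)"
  define C where "C = 2 * C1 * (3 + 2 * C2)"
  have "0 < C" using C1 C2 by (simp add: C_def)
  moreover have "(norm (x t - xb))\<^sup>2 \<le> C * (e t + t powr (- p2))" if "T \<le> t" for t
  proof -
    define D where "D = (norm (x t - xb))\<^sup>2"
    define w where "w = t powr (- p2)"
    have t: "T1 \<le> t" "T2 \<le> t" "t0 + 1 \<le> t" using that by (auto simp: T_def)
    obtain z where z: "z \<in> X" "(norm (x t - (xb + \<mu> *\<^sub>R (z - xb))))\<^sup>2 \<le> 2 * (infdist (x t) X)\<^sup>2 + 1 / (2 * C1) * D"
      using \<rho>(2)[OF \<mu> T2[OF t(2)]] unfolding D_def by blast
    have "D \<le> C1 * (e t + (2 * (infdist (x t) X)\<^sup>2 + 1 / (2 * C1) * D))"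
      using C1(2)[OF t(1) z(1)] z(2) C1(1) unfolding D_def by (smt (verit) mult_left_mono)
    also have "\<dots> \<le> C1 * (e t + (2 * (1 * e t + C2 * w) + 1 / (2 * C1) * D))"
      using C2(2)[OF t(3)] C1(1) unfolding w_def by (intro mult_left_mono add_mono order_refl) auto
    also have "\<dots> = C1 * (3 * e t + 2 * C2 * w) + D / 2" using C1 by (simp add: field_simps)
    finally have "D \<le> 2 * C1 * (3 * e t + 2 * C2 * w)" by simp
    also have "\<dots> \<le> 2 * C1 * ((3 + 2 * C2) * e t + (3 + 2 * C2) * w)"
      using C1 C2 e_nonneg[of t] by (intro mult_left_mono add_mono mult_right_mono) (auto simp: w_def)
    finally show ?thesis by (simp add: D_def w_def C_def algebra_simps)
  qed
  ultimately show ?thesis using that by blast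
qed

text \<open>\<open>J xb\<close> eventually decreases, so \<open>E xb\<close> is
  \<open>O(t powr (- p2))\<close>. As \<open>E xb\<close> contains \<open>e\<close>, which by
  \<open>distance_le_e\<close> dominates the squared distance up to the same power,
  \<open>t * f' \<le> A * t powr (- p2) - \<kappa> * f\<close> holds for \<open>f\<close> half that
  squared distance.\<close>

lemma distance_rate:
  obtains C \<kappa> T where "0 < C" "0 < \<kappa>" "\<And>t. T \<le> t \<Longrightarrow> (norm (x t - xb))\<^sup>2 \<le> C * t powr (- \<kappa>)"
proof -
  obtain C T1 where C: "0 < C" "\<And>t. T1 \<le> t \<Longrightarrow> (norm (x t - xb))\<^sup>2 \<le> C * (e t + t powr (- p2))"
    using distance_le_e by blast
  obtain T2 where T2: "\<And>t. T2 \<le> t \<Longrightarrow> \<gamma> * W t \<le> G (x t) \<bullet> (x t - xb)"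
    using flat_eventually unfolding eventually_at_top_linorder by blast
  define T where "T = max (t0 + 1) (max T1 T2)"
  have T: "t0 < T" "1 \<le> T" "T1 \<le> T" "T2 \<le> T" using t0 by (auto simp: T_def)
  define B where "B = \<bar>J xb T\<bar> + 1"
  define A where "A = 2 / p * B"
  have A: "0 < A" using p by (simp add: A_def B_def)
  \<comment> \<open>Taking at most \<open>p2 / 2\<close> keeps \<open>\<kappa> < p2\<close>, so the
    inhomogeneous term remains integrable after multiplication by
    \<open>t powr (\<kappa> - 1)\<close>.\<close>
  define \<kappa> where "\<kappa> = min (4 / (p * C)) (p2 / 2)"
  have \<kappa>: "0 < \<kappa>" "\<kappa> \<le> 4 / (p * C)" "\<kappa> < p2" using p C p2 by (auto simp: \<kappa>_def)
  define f where "f t = (x t - xb) \<bullet> (x t - xb) / 2" for t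
  have g_le: "t * (v t \<bullet> (x t - xb)) \<le> A * t powr (- p2) - \<kappa> * f t" if t: "T \<le> t" for t
  proof -
    define w where "w = t powr (- p2)"
    have t_pos: "0 < t" "1 \<le> t" using t T by auto
    have "J xb t \<le> J xb T" using T t T2 by (intro J_antimono) auto
    then have "t powr p * E xb t \<le> \<bar>J xb T\<bar>" unfolding J_def[of xb t] by linarith
    then have "E xb t \<le> \<bar>J xb T\<bar> * t powr (- p)" using t_pos by (simp add: powr_minus field_simps)
    also have "\<dots> \<le> \<bar>J xb T\<bar> * w" unfolding w_def using t_pos p2 by (intro mult_left_mono powr_mono) auto
    finally have 1: "p / 2 * (t * (v t \<bullet> (x t - xb))) \<le> \<bar>J xb T\<bar> * w - e t" by (simp add: E_def)
    have f: "2 * f t = (norm (x t - xb))\<^sup>2" by (simp add: f_def power2_norm_eq_inner)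
    have "2 * f t / C \<le> e t + w" using C(2)[of t] t T C(1) unfolding f w_def by (simp add: field_simps)
    then have "p / 2 * (t * (v t \<bullet> (x t - xb))) \<le> B * w - 2 * f t / C"
      using 1 by (simp add: B_def distrib_right)
    then have "2 / p * (p / 2 * (t * (v t \<bullet> (x t - xb)))) \<le> 2 / p * (B * w - 2 * f t / C)"
      using p by (intro mult_left_mono) auto
    then have "t * (v t \<bullet> (x t - xb)) \<le> A * w - 4 / (p * C) * f t"
      using p C by (simp add: A_def right_diff_distrib mult.assoc)
    moreover have "\<kappa> * f t \<le> 4 / (p * C) * f t" by (intro mult_right_mono \<kappa>) (simp add: f_def)
    ultimately show ?thesis by (simp add: w_def)
  qed
  define Z where "Z t = t powr \<kappa> * f t + A / (p2 - \<kappa>) * t powr (\<kappa> - p2)" for t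
  have Z: "Z t \<le> Z T" if "T \<le> t" for t
  proof (rule deriv_nonpos_antimono[OF that])
    fix r assume r': "T \<le> r"
    then have r: "0 < r" "t0 < r" using T by auto
    show "(Z has_real_derivative (\<kappa> * r powr (\<kappa> - 1)) * f r + (v r \<bullet> (x r - xb)) * r powr \<kappa>
      + A / (p2 - \<kappa>) * ((\<kappa> - p2) * r powr (\<kappa> - p2 - 1))) (at r)"
      unfolding Z_def f_def
      by (intro DERIV_add DERIV_mult DERIV_cmult f_deriv has_real_derivative_powr r)
    have "(\<kappa> * r powr (\<kappa> - 1)) * f r + (v r \<bullet> (x r - xb)) * r powr \<kappa>
      + A / (p2 - \<kappa>) * ((\<kappa> - p2) * r powr (\<kappa> - p2 - 1))
      = r powr (\<kappa> - 1) * (\<kappa> * f r + r * (v r \<bullet> (x r - xb)) - A * r powr (- p2))"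
    proof -
      have "A / (p2 - \<kappa>) * ((\<kappa> - p2) * r powr (\<kappa> - p2 - 1)) = - (A * r powr (\<kappa> - p2 - 1))"
        using \<kappa> by (simp add: field_simps)
      moreover have "\<kappa> - p2 - 1 = (\<kappa> - 1) + (- p2)" by simp
      then have "r powr (\<kappa> - p2 - 1) = r powr (\<kappa> - 1) * r powr (- p2)" by (simp only: powr_add)
      moreover have "r powr \<kappa> = r powr (\<kappa> - 1) * r" using r by (simp add: powr_diff)
      ultimately show ?thesis by (simp add: algebra_simps)
    qed
    also have "\<dots> \<le> 0" using g_le[OF r'] by (intro mult_nonneg_nonpos) auto
    finally show "(\<kappa> * r powr (\<kappa> - 1)) * f r + (v r \<bullet> (x r - xb)) * r powr \<kappa>
      + A / (p2 - \<kappa>) * ((\<kappa> - p2) * r powr (\<kappa> - p2 - 1)) \<le> 0" .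
  qed
  have "(norm (x t - xb))\<^sup>2 \<le> (2 * \<bar>Z T\<bar> + 1) * t powr (- \<kappa>)" if "T \<le> t" for t
  proof -
    have "0 < t" using that T by simp
    have "0 \<le> A / (p2 - \<kappa>) * t powr (\<kappa> - p2)" using A \<kappa> by simp
    then have "t powr \<kappa> * f t \<le> \<bar>Z T\<bar>" using Z[OF that] unfolding Z_def[of t] by linarith
    then have "t powr \<kappa> * (2 * f t) \<le> 2 * \<bar>Z T\<bar> + 1" by simp
    then show ?thesis using \<open>0 < t\<close> unfolding f_def
      by (simp add: powr_minus power2_norm_eq_inner field_simps)
  qed
  then show ?thesis using that[of "2 * \<bar>Z T\<bar> + 1" \<kappa> T] \<kappa> by auto
qed

text \<open>The center depends on the final time \<open>T\<close> but is fixed along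
  \<open>{s..T}\<close>, where \<open>J c\<close> grows only by the flatness loss, proportional to
  \<open>\<mu>\<close>. For \<open>T\<close> a maximum point of \<open>h\<close> this loss is at
  most a multiple of \<open>\<mu> * h T * ln T\<close>, which is absorbed since \<open>\<mu>\<close>
  decays polynomially.\<close>

lemma e_rate:
  obtains K T where "\<And>t. T \<le> t \<Longrightarrow> e t \<le> K * t powr (- p2)"
proof -
  obtain C1 T1 where C1: "0 < C1" "\<And>t. T1 \<le> t \<Longrightarrow> (norm (x t - xb))\<^sup>2 \<le> C1 * (e t + t powr (- p2))"
    using distance_le_e by blast
  obtain C2 \<kappa> T2 where C2: "0 < C2" "0 < \<kappa>" "\<And>t. T2 \<le> t \<Longrightarrow> (norm (x t - xb))\<^sup>2 \<le> C2 * t powr (- \<kappa>)"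
    using distance_rate by blast
  \<comment> \<open>\<open>norm (x T - xb)\<close> is of order
    \<open>T powr (- \<kappa> / 2)\<close>, hence eventually below
    \<open>\<rho> * T powr (- \<sigma>)\<close>, as \<open>homothetic_distance\<close> demands for
    \<open>\<mu> = T powr (- \<sigma>)\<close>.\<close>
  define \<sigma> where "\<sigma> = \<kappa> / 4"
  define \<delta> where "\<delta> = 1 / (2 * p\<^sup>2 * C1)"
  have \<delta>: "0 < \<delta>" "p\<^sup>2 / 4 * \<delta> * C1 = 1 / 8" using p C1 by (auto simp: \<delta>_def)
  obtain \<rho> where \<rho>: "0 < \<rho>" "\<And>t \<mu>. 0 < \<mu> \<Longrightarrow> \<mu> \<le> 1 \<Longrightarrow> norm (x t - xb) \<le> \<rho> * \<mu> \<Longrightarrow>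
     \<exists>z\<in>X. (norm (x t - (xb + \<mu> *\<^sub>R (z - xb))))\<^sup>2 \<le> 2 * (infdist (x t) X)\<^sup>2 + \<delta> * (norm (x t - xb))\<^sup>2"
    using homothetic_distance[OF \<delta>(1)] by blast
  obtain C3 where C3: "0 < C3" "\<And>t. t0 + 1 \<le> t \<Longrightarrow> (infdist (x t) X)\<^sup>2 \<le> 1 / (4 * p\<^sup>2) * e t + C3 * t powr (- p2)"
    using infdist_le_e[of "1 / (4 * p\<^sup>2)"] p by auto
  obtain T3 where T3: "\<And>t. T3 \<le> t \<Longrightarrow> \<gamma> * W t \<le> G (x t) \<bullet> (x t - xb)"
    using flat_eventually unfolding eventually_at_top_linorder by blast
  have \<sigma>: "0 < \<sigma>" using C2 by (simp add: \<sigma>_def)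
  have "\<forall>\<^sub>F t in at_top. C2 * t powr (- \<kappa>) \<le> (\<rho> * t powr (- \<sigma>))\<^sup>2"
    using C2 \<rho>(1) unfolding \<sigma>_def by real_asymp
  moreover have "\<forall>\<^sub>F t in at_top. t powr (- \<sigma>) \<le> 1 / 2" using \<sigma> by real_asymp
  moreover have "\<forall>\<^sub>F t in at_top. 4 * p * \<gamma> * t powr (- \<sigma>) * ln t \<le> 1 / 2" using \<sigma> by real_asymp
  ultimately have "\<forall>\<^sub>F t in at_top. C2 * t powr (- \<kappa>) \<le> (\<rho> * t powr (- \<sigma>))\<^sup>2 \<and> t powr (- \<sigma>) \<le> 1 / 2
    \<and> 4 * p * \<gamma> * t powr (- \<sigma>) * ln t \<le> 1 / 2" by eventually_elim auto
  then obtain T4 where T4: "\<And>t. T4 \<le> t \<Longrightarrow> C2 * t powr (- \<kappa>) \<le> (\<rho> * t powr (- \<sigma>))\<^sup>2 \<and> t powr (- \<sigma>) \<le> 1 / 2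
    \<and> 4 * p * \<gamma> * t powr (- \<sigma>) * ln t \<le> 1 / 2"
    unfolding eventually_at_top_linorder by blast
  define s where "s = Max {t0 + 1, 1, T1, T2, T3, T4}"
  have s: "t0 + 1 \<le> s" "1 \<le> s" "T1 \<le> s" "T2 \<le> s" "T3 \<le> s" "T4 \<le> s"
    unfolding s_def by (rule Max_ge, simp, simp)+
  obtain R where R: "0 < R" "\<And>c t. c \<in> X \<Longrightarrow> s \<le> t \<Longrightarrow> norm (x t - c) \<le> R"
    using x_bounded[of s] s by auto
  define A where "A = s powr p * (e s + p / 2 * (sqrt (2 * e s) * R))"
  have A: "0 \<le> A" using p e_nonneg[of s] R by (simp add: A_def)
  have J_s: "J c s \<le> A" if "c \<in> X" for c
  proof -
    have "s * (v s \<bullet> (x s - c)) \<le> sqrt (2 * e s) * norm (x s - c)" using tg_le[of s c] s by auto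
    also have "\<dots> \<le> sqrt (2 * e s) * R" using R(2)[OF that, of s] e_nonneg by (intro mult_left_mono) auto
    finally show ?thesis unfolding J_def E_def A_def using p by (intro mult_left_mono add_left_mono) auto
  qed
  define C4 where "C4 = p\<^sup>2 / 2 * C3 + 1 / 8"
  define h where "h t = t powr p2 * e t" for t
  have main: "h T \<le> 8 * (A + C4)"
    if T: "s \<le> T" and max: "\<And>t. s \<le> t \<Longrightarrow> t \<le> T \<Longrightarrow> h t \<le> h T" for T
  proof -
    define \<mu> where "\<mu> = T powr (- \<sigma>)"
    have Tp: "0 < T" "1 \<le> T" "T4 \<le> T" using s T by auto
    have \<mu>: "0 < \<mu>" "\<mu> \<le> 1 / 2" "C2 * T powr (- \<kappa>) \<le> (\<rho> * \<mu>)\<^sup>2" "4 * p * \<gamma> * \<mu> * ln T \<le> 1 / 2"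
      using T4[OF Tp(3)] Tp by (auto simp: \<mu>_def)
    define D where "D = norm (x T - xb)"
    have "D\<^sup>2 \<le> (\<rho> * \<mu>)\<^sup>2" using C2(3)[of T] s T \<mu>(3) by (simp add: D_def)
    then have "D \<le> \<rho> * \<mu>" using power2_le_imp_le[of D "\<rho> * \<mu>"] \<rho>(1) \<mu> by simp
    then obtain z where z: "z \<in> X" "(norm (x T - (xb + \<mu> *\<^sub>R (z - xb))))\<^sup>2 \<le> 2 * (infdist (x T) X)\<^sup>2 + \<delta> * D\<^sup>2"
      using \<rho>(2)[of \<mu> T] \<mu> unfolding D_def by auto
    define c where "c = xb + \<mu> *\<^sub>R (z - xb)"
    define d where "d = norm (x T - c)"
    have c: "c \<in> X" unfolding c_def using z \<mu> by (intro homothetic_center_in) auto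
    \<comment> \<open>\<open>k / r\<close> bounds the derivative of \<open>J c\<close> at
      \<open>r\<close>: both \<open>h r \<le> h T\<close>, by maximality, and
      \<open>r powr (p - p2) \<le> T powr (p - p2)\<close>, by \<open>p2 \<le> p\<close>,
      enter.\<close>
    define k where "k = p * \<gamma> * \<mu> * h T * T powr (p - p2)"
    have hT: "0 \<le> h T" using e_nonneg by (simp add: h_def)
    have "J c T - k * ln T \<le> J c s - k * ln s"
    proof (rule deriv_nonpos_antimono[OF T])
      fix r assume r': "s \<le> r" "r \<le> T"
      then have r: "0 < r" "t0 < r" "T3 \<le> r" using s t0 by auto
      define Pc where "Pc = G (x r) \<bullet> (x r - c)"
      show "((\<lambda>t. J c t - k * ln t) has_real_derivative r powr (p + 1) * ((2 + p) * W r - p / 2 * Pc) - k * (1 / r)) (at r)"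
        unfolding Pc_def using r by (intro DERIV_diff DERIV_cmult J_deriv) (auto intro!: derivative_eq_intros)
      have "0 \<le> \<gamma> * W r" using \<gamma> W_nonneg[of r] by simp
      then have "0 \<le> \<mu> * (G (x r) \<bullet> (x r - xb))" using T3[OF r(3)] \<mu>(1) by simp
      moreover have "(2 + p) * W r - p / 2 * Pc \<le> p / 2 * (2 * \<mu> * \<gamma> * W r - \<mu> * (G (x r) \<bullet> (x r - xb)))"
        unfolding Pc_def c_def using z \<mu> T3[OF r(3)] by (intro homothetic_center) auto
      ultimately have "(2 + p) * W r - p / 2 * Pc \<le> p / 2 * (2 * \<mu> * \<gamma> * W r)"
        using p by (smt (verit) mult_left_mono half_gt_zero)
      then have "r powr (p + 1) * ((2 + p) * W r - p / 2 * Pc) \<le> r powr (p + 1) * (p / 2 * (2 * \<mu> * \<gamma> * W r))"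
        by (intro mult_left_mono) auto
      also have "\<dots> = p * \<gamma> * \<mu> * (r powr (p - 1) * (r\<^sup>2 * W r))"
      proof -
        have "r powr (p + 1) = r powr (p - 1) * r\<^sup>2"
          using r by (simp add: powr_add powr_diff power2_eq_square)
        then show ?thesis by simp
      qed
      also have "\<dots> \<le> p * \<gamma> * \<mu> * (r powr (p - 1) * e r)"
        using p \<gamma> \<mu> W_le_e by (intro mult_left_mono) auto
      also have "r powr (p - 1) * e r = r powr (p - p2) * h r / r"
        unfolding h_def using r by (simp add: powr_diff)
      also have "p * \<gamma> * \<mu> * (r powr (p - p2) * h r / r) \<le> p * \<gamma> * \<mu> * (T powr (p - p2) * h T / r)"
        using p \<gamma> \<mu> r r' hT p2 max[OF r'] e_nonneg[of r]
        by (intro mult_left_mono divide_right_mono mult_mono powr_mono2) (auto simp: h_def)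
      also have "\<dots> = k * (1 / r)" by (simp add: k_def)
      finally show "r powr (p + 1) * ((2 + p) * W r - p / 2 * Pc) - k * (1 / r) \<le> 0" by simp
    qed
    moreover have "0 \<le> k * ln s" using s hT p \<gamma> \<mu> by (simp add: k_def)
    ultimately have "J c T \<le> A + k * ln T" using J_s[OF c] by linarith
    then have "E c T \<le> A * T powr (- p) + p * \<gamma> * \<mu> * h T * ln T * T powr (- p2)"
      unfolding J_def k_def using Tp by (simp add: powr_minus powr_diff field_simps)
    also have "A * T powr (- p) \<le> A * T powr (- p2)" using A Tp p2 by (intro mult_left_mono powr_mono) auto
    finally have E_le: "E c T \<le> (A + p * \<gamma> * \<mu> * h T * ln T) * T powr (- p2)" by (simp add: distrib_right)
    \<comment> \<open>Half of \<open>e T\<close> is given up for the cross term. Of the rest, growth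
      and the error of the center cost \<open>e T / 8\<close> each, so \<open>e T / 4\<close>
      survives.\<close>
    have "e T / 2 - p\<^sup>2 / 4 * d\<^sup>2 \<le> E c T"
    proof -
      define w where "w = sqrt (2 * e T)"
      have w: "w\<^sup>2 = 2 * e T" using e_nonneg by (simp add: w_def)
      have "- (w * d) \<le> T * (v T \<bullet> (x T - c))" using tg_le[of T c] Tp by (auto simp: w_def d_def)
      then have "p / 2 * (- (w * d)) \<le> p / 2 * (T * (v T \<bullet> (x T - c)))" using p by (intro mult_left_mono) auto
      moreover have "0 \<le> (w / 2 - p / 2 * d)\<^sup>2" by simp
      then have "p / 2 * (w * d) \<le> w\<^sup>2 / 4 + p\<^sup>2 / 4 * d\<^sup>2" by (simp add: power2_eq_square field_simps)
      ultimately show ?thesis unfolding E_def using w by linarith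
    qed
    moreover have "p\<^sup>2 / 4 * d\<^sup>2 \<le> e T / 4 + C4 * T powr (- p2)"
    proof -
      have "d\<^sup>2 \<le> 2 * (1 / (4 * p\<^sup>2) * e T + C3 * T powr (- p2)) + \<delta> * (C1 * (e T + T powr (- p2)))"
        using z(2) C3(2)[of T] C1(2)[of T] s T \<delta> unfolding d_def c_def D_def
        by (smt (verit) mult_left_mono)
      then have "p\<^sup>2 / 4 * d\<^sup>2 \<le> p\<^sup>2 / 4 * (2 * (1 / (4 * p\<^sup>2) * e T + C3 * T powr (- p2)) + \<delta> * (C1 * (e T + T powr (- p2))))"
        by (intro mult_left_mono) auto
      also have "\<dots> = e T / 8 + p\<^sup>2 / 2 * C3 * T powr (- p2) + (p\<^sup>2 / 4 * \<delta> * C1) * (e T + T powr (- p2))"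
        using p by (simp add: field_simps)
      finally show ?thesis unfolding \<delta>(2) by (simp add: C4_def algebra_simps)
    qed
    ultimately have "e T / 4 \<le> (A + p * \<gamma> * \<mu> * h T * ln T + C4) * T powr (- p2)"
      using E_le by (simp add: distrib_right)
    then have "T powr p2 * (e T / 4) \<le> T powr p2 * ((A + p * \<gamma> * \<mu> * h T * ln T + C4) * T powr (- p2))"
      by (intro mult_left_mono) auto
    moreover have "T powr p2 * (B * T powr (- p2)) = B" for B using Tp by (simp add: powr_minus)
    moreover have "T powr p2 * (e T / 4) = h T / 4" by (simp add: h_def)
    ultimately have "h T / 4 \<le> A + p * \<gamma> * \<mu> * h T * ln T + C4" by simp
    moreover have "4 * (p * \<gamma> * \<mu> * h T * ln T) \<le> 1 / 2 * h T"
      using mult_right_mono[OF \<mu>(4) hT] by (simp add: mult_ac)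
    ultimately show ?thesis by simp
  qed
  have "e t \<le> 8 * (A + C4) * t powr (- p2)" if st: "s \<le> t" for t
  proof -
    have "continuous_on {s..t} h"
      unfolding h_def e_def using s t0
      by (intro continuous_intros continuous_on_subset[OF continuous_en[of s]]) auto
    \<comment> \<open>A maximum point of \<open>h\<close> over \<open>{s..t}\<close> is also one
      over \<open>{s..T}\<close>, as \<open>main\<close> requires.\<close>
    then obtain T where T: "T \<in> {s..t}" "\<And>u. u \<in> {s..t} \<Longrightarrow> h u \<le> h T"
      using continuous_attains_sup[of "{s..t}" h] st by auto
    then have "h T \<le> 8 * (A + C4)" by (intro main) auto
    then have "h t \<le> 8 * (A + C4)" using T(2)[of t] that by simp
    then show ?thesis using s that by (simp add: h_def powr_minus field_simps)
  qed
  then show ?thesis using that by blast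
qed

end

context critical_flow
begin

lemma W_rate: "\<exists>K T. \<forall>t\<ge>T. W t \<le> K * t powr (- (2 / (1 - q)))"
proof -
  obtain xb where "xb \<in> X" "(x \<longlongrightarrow> xb) at_top" "(e \<longlongrightarrow> 0) at_top"
    using trajectory_converges by blast
  then interpret critical_flow_limit F G m X p t0 x v q \<gamma> xb by unfold_locales
  obtain K T where K: "\<And>t. T \<le> t \<Longrightarrow> e t \<le> K * t powr (- p2)" using e_rate by blast
  have "W t \<le> K * t powr (- (2 / (1 - q)))" if "max 1 T \<le> t" for t
  proof -
    have t: "0 < t" "T \<le> t" using that by auto
    have "t\<^sup>2 * W t \<le> K * t powr (- p2)" using W_le_e K[OF t(2)] order_trans by blast
    then have "W t \<le> K * (t powr (- p2) * t powr (- 2))" using t by (simp add: powr_minus field_simps)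
    also have "t powr (- p2) * t powr (- 2) = t powr (- (2 / (1 - q)))"
      using q by (simp add: p2_def field_simps flip: powr_add)
    finally show ?thesis .
  qed
  then show ?thesis by blast
qed

end

section \<open>The rate of decay\<close>

text \<open>The derivative is represented by the vector \<open>adjoint D 1\<close>; uniqueness of
  derivatives makes it the value of the definite description in \<open>gradient\<close>.\<close>

lemma has_derivative_gradient:
  fixes F :: "real ^ 'n \<Rightarrow> real"
  assumes "F differentiable (at y)"
  shows "(F has_derivative (\<lambda>h. gradient F y \<bullet> h)) (at y)"
proof -
  obtain D where D: "(F has_derivative D) (at y)" using assms by (auto simp: differentiable_def)
  then have "linear D" by (rule has_derivative_linear)
  then have "D = (\<lambda>h. h \<bullet> adjoint D 1)" by (simp add: adjoint_works fun_eq_iff)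
  with D have g: "GDERIV F y :> adjoint D 1" by (simp add: gderiv_def)
  have "gradient F y = adjoint D 1"
    unfolding gradient_def
  proof (rule the_equality[of "\<lambda>g. GDERIV F y :> g", OF g])
    fix g' assume "GDERIV F y :> g'"
    with g have "(\<lambda>h. h \<bullet> g') = (\<lambda>h. h \<bullet> adjoint D 1)"
      unfolding gderiv_def by (intro has_derivative_unique)
    then have "\<And>h. h \<bullet> g' = h \<bullet> adjoint D 1" by (rule fun_cong)
    then show "g' = adjoint D 1" using vector_eq_ldot by blast
  qed
  then show ?thesis using g by (simp add: gderiv_def inner_commute)
qed

text \<open>Along the segment to \<open>z\<close>, convexity bounds every difference quotient with
  step in \<open>(0, 1)\<close> by \<open>F z - F y\<close>; the quotients tend to
  \<open>g \<bullet> (z - y)\<close>.\<close>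

lemma convex_on_tangent_le:
  fixes F :: "'a::real_inner \<Rightarrow> real"
  assumes "convex_on UNIV F" "(F has_derivative (\<lambda>h. g \<bullet> h)) (at y)"
  shows "F y + g \<bullet> (z - y) \<le> F z"
proof -
  have "((\<lambda>s. y + s *\<^sub>R (z - y)) has_derivative (\<lambda>s. s *\<^sub>R (z - y))) (at (0::real))"
    by (auto intro!: derivative_eq_intros)
  moreover have "(F has_derivative (\<lambda>h. g \<bullet> h)) (at (y + 0 *\<^sub>R (z - y)))" using assms(2) by simp
  ultimately have "((\<lambda>s. F (y + s *\<^sub>R (z - y))) has_derivative (\<lambda>s. g \<bullet> (s *\<^sub>R (z - y)))) (at (0::real))"
    by (rule has_derivative_compose)
  then have "((\<lambda>s. F (y + s *\<^sub>R (z - y))) has_real_derivative g \<bullet> (z - y)) (at 0)"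
    unfolding has_field_derivative_def by (simp add: mult_commute_abs)
  then have "((\<lambda>s. (F (y + s *\<^sub>R (z - y)) - F y) / s) \<longlongrightarrow> g \<bullet> (z - y)) (at_right 0)"
    unfolding DERIV_def by (simp add: filterlim_at_split)
  moreover have "\<forall>\<^sub>F s in at_right (0::real). (F (y + s *\<^sub>R (z - y)) - F y) / s \<le> F z - F y"
    using eventually_at_right_real[of 0 1, OF zero_less_one]
  proof eventually_elim
    case (elim s)
    have "F ((1 - s) *\<^sub>R y + s *\<^sub>R z) \<le> (1 - s) * F y + s * F z"
      using elim by (intro convex_onD[OF assms(1)]) auto
    moreover have "(1 - s) *\<^sub>R y + s *\<^sub>R z = y + s *\<^sub>R (z - y)" by (simp add: algebra_simps)
    ultimately show ?case using elim by (simp add: field_simps)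
  qed
  ultimately have "g \<bullet> (z - y) \<le> F z - F y"
    by (intro tendsto_upperbound) auto
  then show ?thesis by simp
qed

lemma minimizers_eq:
  assumes "minimizers F \<noteq> {}"
  shows "inf_value F \<le> F y" "minimizers F = {y. F y = inf_value F}"
proof -
  obtain c where "c \<in> minimizers F" using assms by auto
  then have c: "F c \<le> F y" for y by (auto simp: minimizers_def is_arg_min_def not_less)
  then have "inf_value F = F c" unfolding inf_value_def by (intro cInf_eq_minimum) auto
  then show "inf_value F \<le> F y" "minimizers F = {y. F y = inf_value F}"
    using c by (auto simp: minimizers_def is_arg_min_def not_less intro: antisym order_trans)
qed

lemma coercive_bounded_sublevel:
  assumes "coercive F"
  shows "bounded {y. F y \<le> B}"
proof -
  have "\<forall>\<^sub>F y in at_infinity. B < F y"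
    using assms unfolding coercive_def filterlim_at_top_dense by blast
  then obtain R where "\<And>y. R \<le> norm y \<Longrightarrow> B < F y" by (auto simp: eventually_at_infinity)
  then show ?thesis unfolding bounded_iff by (intro exI[of _ R]) (metis linorder_le_cases mem_Collect_eq not_less)
qed

text \<open>Near a minimizer this is the local growth condition raised to the power
  \<open>2 / \<gamma>\<close>; near any other point \<open>F - m\<close> is bounded below by a
  positive number, so a large constant suffices. Compactness of the sublevel set leaves finitely
  many constants, and their sum dominates each.\<close>

lemma H2_growth:
  fixes F :: "real ^ 'n \<Rightarrow> real"
  assumes H2: "H2 \<gamma> F" and \<gamma>: "0 < \<gamma>" and ne: "minimizers F \<noteq> {}"
    and cont: "continuous_on UNIV F" and coer: "coercive F"
  shows "\<exists>C>0. \<forall>y. F y \<le> B \<longrightarrow>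
    (infdist y (minimizers F))\<^sup>2 \<le> C * (F y - inf_value F) powr (2 / \<gamma>)"
proof -
  define X where "X = minimizers F"
  define m where "m = inf_value F"
  define d where "d y = infdist y X" for y
  have m: "m \<le> F y" "X = {y. F y = m}" for y
    using minimizers_eq[OF ne] by (auto simp: X_def m_def)
  have "\<exists>r C. 0 < r \<and> 0 \<le> C \<and> (\<forall>y\<in>ball c r. (d y)\<^sup>2 \<le> C * (F y - m) powr (2 / \<gamma>))" for c
  proof (cases "c \<in> X")
    case True
    then obtain K \<epsilon> where K: "0 < K" "0 < \<epsilon>" "\<And>y. y \<in> ball c \<epsilon> \<Longrightarrow> K * d y powr \<gamma> \<le> F y - m"
      using H2 unfolding H2_def X_def m_def d_def by metis
    have "(d y)\<^sup>2 \<le> K powr (- 2 / \<gamma>) * (F y - m) powr (2 / \<gamma>)" if "y \<in> ball c \<epsilon>" for y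
    proof -
      have "d y powr \<gamma> \<le> (F y - m) / K" using K(3)[OF that] K(1) by (simp add: field_simps)
      then have "(d y powr \<gamma>) powr (2 / \<gamma>) \<le> ((F y - m) / K) powr (2 / \<gamma>)"
        using \<gamma> by (intro powr_mono2) auto
      moreover have "(d y powr \<gamma>) powr (2 / \<gamma>) = (d y)\<^sup>2"
        using \<gamma> by (simp add: powr_powr d_def infdist_nonneg)
      ultimately show ?thesis
        using K(1) m(1)[of y] by (simp add: powr_divide powr_minus field_simps)
    qed
    then show ?thesis using K by (intro exI[of _ \<epsilon>] exI[of _ "K powr (- 2 / \<gamma>)"]) auto
  next
    case False
    then have mc: "m < F c" using m(1)[of c] m(2) by auto
    define k where "k = (F c - m) / 2"
    have k: "0 < k" using mc by (simp add: k_def)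
    have "open {y. m + k < F y}" using cont by (intro open_Collect_less) auto
    moreover have "m + k < F c" using mc by (simp add: k_def field_simps)
    ultimately obtain r where r: "0 < r" "ball c r \<subseteq> {y. m + k < F y}"
      unfolding open_contains_ball by blast
    have "(d y)\<^sup>2 \<le> ((d c + r)\<^sup>2 / k powr (2 / \<gamma>)) * (F y - m) powr (2 / \<gamma>)" if y: "y \<in> ball c r" for y
    proof -
      have "d y \<le> d c + dist y c" unfolding d_def by (rule infdist_triangle)
      then have "d y \<le> d c + r" using y by (simp add: dist_commute)
      then have "(d y)\<^sup>2 \<le> (d c + r)\<^sup>2" by (intro power_mono) (auto simp: d_def infdist_nonneg)
      also have "\<dots> = (d c + r)\<^sup>2 / k powr (2 / \<gamma>) * k powr (2 / \<gamma>)" using k by simp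
      also have "\<dots> \<le> (d c + r)\<^sup>2 / k powr (2 / \<gamma>) * (F y - m) powr (2 / \<gamma>)"
        using r y k \<gamma> by (intro mult_left_mono powr_mono2) auto
      finally show ?thesis .
    qed
    then show ?thesis using r by (intro exI[of _ r] exI[of _ "(d c + r)\<^sup>2 / k powr (2 / \<gamma>)"]) auto
  qed
  then obtain r C where rC: "\<And>c. 0 < r c" "\<And>c. 0 \<le> C c"
      "\<And>c y. y \<in> ball c (r c) \<Longrightarrow> (d y)\<^sup>2 \<le> C c * (F y - m) powr (2 / \<gamma>)"
    by metis
  have "compact {y. F y \<le> B}"
    using coercive_bounded_sublevel[OF coer] cont
    by (simp add: compact_eq_bounded_closed closed_Collect_le)
  moreover have "{y. F y \<le> B} \<subseteq> (\<Union>c\<in>{y. F y \<le> B}. ball c (r c))" using rC(1) by auto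
  ultimately obtain I where I: "finite I" "{y. F y \<le> B} \<subseteq> (\<Union>c\<in>I. ball c (r c))"
    by (metis (no_types, lifting) compactE_image open_ball)
  have "(d y)\<^sup>2 \<le> (1 + sum C I) * (F y - m) powr (2 / \<gamma>)" if "F y \<le> B" for y
  proof -
    have "y \<in> (\<Union>c\<in>I. ball c (r c))" using I(2) that by blast
    then obtain c where c: "c \<in> I" "y \<in> ball c (r c)" by blast
    have "C c \<le> 1 + sum C I" using member_le_sum[OF c(1), of C] rC(2) I(1) by simp
    then have "C c * (F y - m) powr (2 / \<gamma>) \<le> (1 + sum C I) * (F y - m) powr (2 / \<gamma>)"
      by (intro mult_right_mono) auto
    then show ?thesis using rC(3)[OF c(2)] by simp
  qed
  moreover have "0 < 1 + sum C I" using rC(2) by (simp add: add_pos_nonneg sum_nonneg)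
  ultimately show ?thesis unfolding d_def X_def m_def by blast
qed

theorem theorem3p4:
  fixes F :: "real ^ 'n \<Rightarrow> real"
    and \<alpha> \<theta> t0 \<gamma>1 \<gamma>2 r :: real
    and x v :: "real \<Rightarrow> real ^ 'n"
  assumes "convex_on UNIV F"
    and "\<forall>y. F differentiable (at y)"
    and "minimizers F \<noteq> {}"
    and "\<alpha> > 0"
    and "0 \<le> \<theta>" and "\<theta> \<le> 1"
    and "t0 > 0"
    and "\<gamma>1 > 2"
    and "\<gamma>2 \<ge> \<gamma>1"
    and "r = (1 + \<theta>) / 2"
    and "well_posed F \<alpha> \<theta> t0"
    and "ode_solution F \<alpha> \<theta> t0 x v"
    and "coercive F"
    and "H1 \<gamma>1 F"
    and "H2 \<gamma>2 F"
    and "(\<theta> = 1 \<and> \<alpha> \<ge> (\<gamma>1 + 2) / (\<gamma>1 - 2)) \<or> \<theta> < 1"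
  shows "(\<lambda>t. F (x t) - inf_value F) \<in> O[at_top](\<lambda>t. 1 / t powr (2 * r * \<gamma>2 / (\<gamma>2 - 2)))"
proof -
  define m where "m = inf_value F"
  define X where "X = minimizers F"
  define q where "q = 2 / \<gamma>2"
  have q: "0 < q" "q < 1" using assms(8,9) by (auto simp: q_def)
  \<comment> \<open>Both regimes deliver the rate in this form; at \<open>\<theta> = 1\<close> it
    reads \<open>2 / (1 - q)\<close>.\<close>
  have exponent: "2 * r * \<gamma>2 / (\<gamma>2 - 2) = (1 + \<theta>) / (1 - q)"
    using assms(8-10) by (simp add: q_def field_simps)
  have grad: "(F has_derivative (\<lambda>h. gradient F y \<bullet> h)) (at y)" for y
    using has_derivative_gradient assms(2) by blast
  have cont: "continuous_on UNIV F"
    using grad has_derivative_continuous by (metis continuous_at_imp_continuous_on)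
  have X: "m \<le> F y" "X = {y. F y = m}" for y
    using minimizers_eq[OF assms(3)] by (auto simp: X_def m_def)
  have "convex X"
  proof (rule convexI)
    fix y z :: "real ^ 'n" and a b :: real
    assume "y \<in> X" "z \<in> X" "0 \<le> a" "0 \<le> b" "a + b = 1"
    moreover from this have "F (a *\<^sub>R y + b *\<^sub>R z) \<le> a * F y + b * F z"
      using assms(1) unfolding convex_on_def by auto
    ultimately have "F (a *\<^sub>R y + b *\<^sub>R z) \<le> m" using X(2) by (simp flip: distrib_right)
    then show "a *\<^sub>R y + b *\<^sub>R z \<in> X" using X by (simp add: antisym)
  qed
  have x_deriv: "(x has_vector_derivative v t) (at t)"
    and v_deriv: "(v has_vector_derivative - ((\<alpha> / t powr \<theta>) *\<^sub>R v t) - gradient F (x t)) (at t)"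
    if t: "t0 < t" for t
  proof -
    have at: "at t within {t0..} = at t" using t by (intro at_within_interior) auto
    have "t0 \<le> t" using t by simp
    then obtain a where a: "(x has_vector_derivative v t) (at t)" "(v has_vector_derivative a) (at t)"
      "a + (\<alpha> / t powr \<theta>) *\<^sub>R v t + gradient F (x t) = 0"
      using assms(12) unfolding ode_solution_def at[symmetric] by blast
    have "a = (a + (\<alpha> / t powr \<theta>) *\<^sub>R v t + gradient F (x t))
        - (\<alpha> / t powr \<theta>) *\<^sub>R v t - gradient F (x t)" by simp
    then have "a = - ((\<alpha> / t powr \<theta>) *\<^sub>R v t) - gradient F (x t)" unfolding a(3) by simp
    with a show "(x has_vector_derivative v t) (at t)"
      "(v has_vector_derivative - ((\<alpha> / t powr \<theta>) *\<^sub>R v t) - gradient F (x t)) (at t)" by auto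
  qed
  \<comment> \<open>Only the values of \<open>a\<close> after \<open>t0\<close> matter, so the same
    fact serves \<open>\<alpha> * t powr (- \<theta>)\<close> and
    \<open>(1 + p) / t\<close>.\<close>
  have flow: "damped_flow_growth F (gradient F) m X a t0 x v q"
    if a: "\<And>t. t0 < t \<Longrightarrow> a t = \<alpha> / t powr \<theta>" for a
  proof
    show "F y + gradient F y \<bullet> (z - y) \<le> F z" for y z by (rule convex_on_tangent_le[OF assms(1) grad])
    show "bounded {y. F y \<le> B}" for B by (rule coercive_bounded_sublevel[OF assms(13)])
    show "\<exists>C>0. \<forall>y. F y \<le> B \<longrightarrow> (infdist y X)\<^sup>2 \<le> C * (F y - m) powr q" for B
      unfolding X_def m_def q_def
      using H2_growth[OF assms(15) _ assms(3) cont assms(13)] assms(8,9) by simp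
    show "0 \<le> a t" if "t0 < t" for t using a[OF that] assms(4) by simp
    show "(v has_vector_derivative - (a t *\<^sub>R v t) - gradient F (x t)) (at t)" if "t0 < t" for t
      using v_deriv[OF that] a[OF that] by simp
  qed (use grad X assms(3,7) \<open>convex X\<close> x_deriv q in \<open>auto simp: X_def[symmetric]\<close>)
  have "\<exists>K T. \<forall>t\<ge>T. F (x t) - m \<le> K * t powr (- ((1 + \<theta>) / (1 - q)))"
  proof (cases "\<theta> < 1")
    case True
    interpret subcritical_flow F "gradient F" m X \<alpha> \<theta> t0 x v q
    proof (intro subcritical_flow.intro flow)
      show "subcritical_flow_axioms \<alpha> \<theta>" using assms(4,5) True by unfold_locales
    qed (simp add: powr_minus_divide)
    show ?thesis using W_rate unfolding W_def .
  next
    case False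
    then have \<theta>: "\<theta> = 1" "\<alpha> \<ge> (\<gamma>1 + 2) / (\<gamma>1 - 2)" using assms(6,16) by auto
    define p where "p = \<alpha> - 1"
    \<comment> \<open>The bound on \<open>\<alpha>\<close> in terms of \<open>p\<close>. It yields
      both \<open>p\<gamma>\<close> and, through \<open>\<gamma>1 \<le> \<gamma>2\<close>, the
      comparison \<open>pq\<close>.\<close>
    have "4 / (\<gamma>1 - 2) \<le> p" using \<theta>(2) assms(8) by (simp add: p_def field_simps)
    then have p4: "4 \<le> p * (\<gamma>1 - 2)" using assms(8) by (simp add: field_simps)
    interpret critical_flow F "gradient F" m X p t0 x v q \<gamma>1
    proof (intro critical_flow.intro flow)
      show "(1 + p) / t = \<alpha> / t powr \<theta>" if "t0 < t" for t
        using that assms(7) by (simp add: p_def \<theta>)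
      show "critical_flow_axioms F (gradient F) m X p q \<gamma>1"
      proof
        have "0 < p * (\<gamma>1 - 2)" using p4 by linarith
        then show p: "0 < p" using assms(8) by (simp add: zero_less_mult_iff)
        show "2 + p \<le> p / 2 * \<gamma>1" using p4 by (simp add: algebra_simps)
        have "2 * q / (1 - q) = 4 / (\<gamma>2 - 2)" using assms(8,9) by (simp add: q_def field_simps)
        also have "\<dots> \<le> 4 / (\<gamma>1 - 2)" using assms(8,9) by (intro divide_left_mono) auto
        finally show "2 * q / (1 - q) \<le> p" using \<open>4 / (\<gamma>1 - 2) \<le> p\<close> by simp
        fix c assume "c \<in> X"
        then obtain \<eta> where \<eta>: "0 < \<eta>"
            "\<And>y. y \<in> ball c \<eta> \<Longrightarrow> F y - m \<le> (1 / \<gamma>1) * (gradient F y \<bullet> (y - c))"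
          using assms(14) unfolding H1_def X_def m_def by metis
        have "\<gamma>1 * (F y - m) \<le> gradient F y \<bullet> (y - c)" if "y \<in> ball c \<eta>" for y
          using \<eta>(2)[OF that] assms(8) by (simp add: field_simps)
        then show "\<exists>\<eta>>0. \<forall>y\<in>ball c \<eta>. \<gamma>1 * (F y - m) \<le> gradient F y \<bullet> (y - c)"
          using \<eta>(1) by blast
      qed
    qed
    show ?thesis using W_rate unfolding W_def \<theta>(1) by simp
  qed
  then obtain K T where K: "\<And>t. T \<le> t \<Longrightarrow> F (x t) - m \<le> K * t powr (- ((1 + \<theta>) / (1 - q)))" by blast
  show ?thesis
  proof (rule bigoI[of _ K])
    show "\<forall>\<^sub>F t in at_top. norm (F (x t) - inf_value F) \<le> K * norm (1 / t powr (2 * r * \<gamma>2 / (\<gamma>2 - 2)))"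
      using eventually_ge_at_top[of T]
    proof eventually_elim
      case (elim t)
      show ?case using K[OF elim] X(1)[of "x t"]
        unfolding exponent m_def[symmetric] by (simp add: powr_minus_divide)
    qed
  qed
qed

end
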